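(* No infinite group is interpretable in $Th(FG)$, the first-order theory of the Farey graph; that is, no infinite group is interpretable in any model of $Th(FG)$.
   Context: The Farey graph $FG$ has vertex set $\mathbb{Q}\cup\{\infty\}$; each vertex is written as a reduced fraction $p/q$ with $p,q\in\mathbb{Z}$, $\gcd(p,q)=1$, with the convention $\infty=1/0$. Distinct vertices $p/q$ and $r/s$ are joined by an edge if and only if $|ps-qr|=1$. $FG$ is a structure in the language with a single symmetric, irreflexive binary relation symbol (adjacency), and $Th(FG)$ is its complete first-order theory. Interpretable means interpretable with parameters, i.e. definable in $M^{eq}$. *)

theory Defs
  imports Complex_Main "HOL-Algebra.Group"
begin

text \<open>First-order formulas in the language with equality and one binary relation symbol;
  variables are named by natural numbers.\<close>

datatype fm =
    Eq nat nat
  | Adj nat nat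
  | Neg fm
  | Conj fm fm
  | Ex nat fm

primrec free_vars :: "fm \<Rightarrow> nat set" where
  "free_vars (Eq i j) = {i, j}"
| "free_vars (Adj i j) = {i, j}"
| "free_vars (Neg \<phi>) = free_vars \<phi>"
| "free_vars (Conj \<phi> \<psi>) = free_vars \<phi> \<union> free_vars \<psi>"
| "free_vars (Ex i \<phi>) = free_vars \<phi> - {i}"

definition sentence :: "fm \<Rightarrow> bool" where
  "sentence \<phi> \<longleftrightarrow> free_vars \<phi> = {}"

text \<open>Only the restriction of \<open>adj\<close> to \<open>universe\<close> is relevant.  Symmetry and irreflexivity are
  not imposed here: they are first-order, hence inherited by every model of the theory of a graph.
  The same applies to nonemptiness of the universe.\<close>

record 'a rel_structure =
  universe :: "'a set"
  adj :: "'a \<Rightarrow> 'a \<Rightarrow> bool"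

primrec sat :: "'a rel_structure \<Rightarrow> (nat \<Rightarrow> 'a) \<Rightarrow> fm \<Rightarrow> bool" where
  "sat M v (Eq i j) \<longleftrightarrow> v i = v j"
| "sat M v (Adj i j) \<longleftrightarrow> adj M (v i) (v j)"
| "sat M v (Neg \<phi>) \<longleftrightarrow> \<not> sat M v \<phi>"
| "sat M v (Conj \<phi> \<psi>) \<longleftrightarrow> sat M v \<phi> \<and> sat M v \<psi>"
| "sat M v (Ex i \<phi>) \<longleftrightarrow> (\<exists>a \<in> universe M. sat M (v(i := a)) \<phi>)"

text \<open>Used for sentences only, whose truth value does not depend on the assignment.\<close>

definition holds :: "'a rel_structure \<Rightarrow> fm \<Rightarrow> bool" where
  "holds M \<phi> \<longleftrightarrow> (\<forall>v. sat M v \<phi>)"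

definition Th :: "'a rel_structure \<Rightarrow> fm set" where
  "Th M = {\<phi>. sentence \<phi> \<and> holds M \<phi>}"

definition model_of :: "'a rel_structure \<Rightarrow> fm set \<Rightarrow> bool" where
  "model_of M T \<longleftrightarrow> (\<forall>\<phi> \<in> T. holds M \<phi>)"

text \<open>The Farey graph; \<open>None\<close> is the vertex \<open>\<infinity> = 1/0\<close>.  \<open>quotient_of\<close> returns the reduced fraction
  with positive denominator; adjacency does not depend on this choice of sign.\<close>

primrec reduced_fraction :: "rat option \<Rightarrow> int \<times> int" where
  "reduced_fraction None = (1, 0)"
| "reduced_fraction (Some x) = quotient_of x"

definition farey_adj :: "rat option \<Rightarrow> rat option \<Rightarrow> bool" where
  "farey_adj x y \<longleftrightarrow> x \<noteq> y \<and>
     (case reduced_fraction x of (p, q) \<Rightarrow> case reduced_fraction y of (r, s) \<Rightarrow>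
        \<bar>p * s - q * r\<bar> = 1)"

definition farey_graph :: "rat option rel_structure" where
  "farey_graph = \<lparr>universe = UNIV, adj = farey_adj\<rparr>"

definition tuples :: "'a rel_structure \<Rightarrow> nat \<Rightarrow> 'a list set" where
  "tuples M n = {xs. length xs = n \<and> set xs \<subseteq> universe M}"

text \<open>\<open>X\<close> is a subset of the \<open>n\<close>-th power of \<open>M\<close> definable with parameters: variables \<open>0, \<dots>, n - 1\<close>
  of \<open>\<phi>\<close> range over the tuple, the subsequent ones are filled with the parameters \<open>bs\<close>.\<close>

definition definable :: "'a rel_structure \<Rightarrow> nat \<Rightarrow> 'a list set \<Rightarrow> bool" where
  "definable M n X \<longleftrightarrow>
     (\<exists>\<phi> bs. set bs \<subseteq> universe M \<and> free_vars \<phi> \<subseteq> {..<n + length bs} \<and>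
        X = {xs \<in> tuples M n. sat M (\<lambda>i. (xs @ bs) ! i) \<phi>})"

text \<open>An interpretation with parameters of \<open>G\<close> in \<open>M\<close> is a definable set \<open>D\<close> of tuples with a surjective
  coordinate map \<open>f\<close> onto \<open>G\<close> such that the pullbacks of equality and of the graph of multiplication
  are definable; thus \<open>G\<close> is identified with the quotient of \<open>D\<close> by a definable equivalence relation.
  The unit and the inverse are first-order definable from multiplication.\<close>

definition interpretable_group :: "'a rel_structure \<Rightarrow> ('g, 'm) monoid_scheme \<Rightarrow> bool" where
  "interpretable_group M G \<longleftrightarrow> group G \<and>
     (\<exists>n D f. definable M n D \<and> f ` D = carrier G \<and>
        definable M (n + n) {xs @ ys |xs ys. xs \<in> D \<and> ys \<in> D \<and> f xs = f ys} \<and>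
        definable M (n + n + n)
          {xs @ ys @ zs |xs ys zs.
             xs \<in> D \<and> ys \<in> D \<and> zs \<in> D \<and> f xs \<otimes>\<^bsub>G\<^esub> f ys = f zs})"

end

theory Submission
  imports Defs "HOL-Library.Ramsey"
begin

text \<open>Every edge of the Farey graph separates it, so that a set \<open>W\<close> of vertices which is cut out by a bounded
  number of edges interacts with its complement only through a bounded boundary: there are finitely
  many types of tuples in \<open>W\<close>, and tuples of the same type are interchangeable as long as all other
  vertices lie outside \<open>W\<close>.  By Ramsey's theorem every large family of \<open>n\<close>-tuples contains arbitrarily many
  pairs of twins \<open>a\<^sub>i, b\<^sub>i\<close> such that each pair differs only inside a region \<open>W\<^sub>i\<close> of this kind, has the same
  type there, and no vertex lies in more than \<open>n\<close> of the regions.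

  If an infinite group were interpretable, take such pairs among representatives of distinct
  elements.  A tuple \<open>c\<close> representing the product \<open>a\<^sub>1 \<cdots> a\<^sub>R\<close> avoids one of the regions \<open>W\<^sub>i\<close>
  once \<open>R\<close> is large, hence \<open>a\<^sub>i\<close> can be replaced by \<open>b\<^sub>i\<close> without changing the product, which
  contradicts cancellation.  The exchange statement is a scheme of sentences and therefore holds in
  every model of the theory.\<close>

section \<open>Types over a bounded boundary\<close>

text \<open>The product \<open>c\<close> depends on every factor, so the twins must be fixed before
  \<open>c\<close> is known, and \<open>R\<close> must exceed \<open>n\<close> times a bound on the
  number of values taken by \<open>c\<close>, the unit and the parameters. This bound must not grow
  with \<open>R\<close>; hence the partial products are bound by existential quantifiers inside the
  formula, and only the final value is exposed. The obstacle to isolating a region is that a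
  coordinate of one tuple may fall into half-planes attached to another coordinate. Once every
  coordinate is constant or follows a nested chain of half-planes, Ramsey's theorem makes these
  memberships depend only on the order of the indices. The symmetric differences of the half-planes
  at two indices \<open>p < q\<close>, united over the coordinates, then form a region that tuples
  with index outside \<open>[p, q]\<close> miss, while tuples with index strictly between differ
  only inside it. With more such tuples than types, two of them are twins. The bounds do not depend
  on the tuples, so the choice of twins is a finite disjunction, expressible in a first-order
  formula.\<close>

definition view :: "'a set \<Rightarrow> (nat \<Rightarrow> 'a) \<Rightarrow> nat \<Rightarrow> 'a option" where
  "view W v = (\<lambda>i. if v i \<in> W then Some (v i) else None)"

text \<open>\<open>B\<close> may cover a crossing edge from either end, so that the same notion
  serves for symmetric differences, where inside and outside are mixed.\<close>

definition boundary :: "'a rel_structure \<Rightarrow> 'a set \<Rightarrow> 'a set \<Rightarrow> bool" where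
  "boundary M W B \<longleftrightarrow>
     (\<forall>x\<in>W. \<forall>y. y \<notin> W \<longrightarrow> adj M x y \<or> adj M y x \<longrightarrow> x \<in> B \<or> y \<in> B)"

text \<open>The condition also makes \<open>v i \<in> W\<close> and \<open>v' i \<in> W\<close>
  equivalent, so both assignments have the same variables inside.\<close>

definition same_outside :: "'a set \<Rightarrow> (nat \<Rightarrow> 'a) \<Rightarrow> (nat \<Rightarrow> 'a) \<Rightarrow> bool" where
  "same_outside W v v' \<longleftrightarrow> (\<forall>i. v i \<notin> W \<or> v' i \<notin> W \<longrightarrow> v i = v' i)"

definition decides :: "'a rel_structure \<Rightarrow> 'a set \<Rightarrow> ((nat \<Rightarrow> 'a option) \<Rightarrow> 'c) \<Rightarrow> fm \<Rightarrow> bool" where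
  "decides M W f \<phi> \<longleftrightarrow>
     (\<forall>v v'. same_outside W v v' \<longrightarrow> f (view W v) = f (view W v') \<longrightarrow> sat M v \<phi> = sat M v' \<phi>)"

lemma view_update: "view W (v(i := a)) = (view W v)(i := if a \<in> W then Some a else None)"
  by (auto simp: view_def)

lemma same_outside_sym: "same_outside W v v' \<Longrightarrow> same_outside W v' v"
  by (auto simp: same_outside_def)

lemma decidesI:
  assumes "\<And>v v'. same_outside W v v' \<Longrightarrow> f (view W v) = f (view W v') \<Longrightarrow> sat M v \<phi> \<Longrightarrow> sat M v' \<phi>"
  shows "decides M W f \<phi>"
  using assms same_outside_sym unfolding decides_def by metis

lemma decides_recode:
  assumes "decides M W f \<phi>" "\<And>u u'. g u = g u' \<Longrightarrow> f u = f u'"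
  shows "decides M W g \<phi>"
  using assms unfolding decides_def by blast

lemma decides_Eq: "decides M W (\<lambda>u. u i = u j) (Eq i j)"
proof (rule decidesI)
  fix v v'
  assume so: "same_outside W v v'" and f: "(view W v i = view W v j) = (view W v' i = view W v' j)"
    and s: "sat M v (Eq i j)"
  have in_iff: "v k \<in> W \<longleftrightarrow> v' k \<in> W" and out: "v k \<notin> W \<Longrightarrow> v' k = v k" for k
    using so by (auto simp: same_outside_def)
  have e: "v i = v j" using s by simp
  show "sat M v' (Eq i j)"
  proof (cases "v i \<in> W")
    case True
    then have "view W v i = view W v j" using e by (simp only: view_def)
    then have "view W v' i = view W v' j" using f by (simp only:)
    moreover have "v' i \<in> W" "v' j \<in> W" using True e in_iff by metis+
    ultimately show ?thesis by (simp add: view_def)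
  next
    case False
    then show ?thesis using out[of i] out[of j] e by simp
  qed
qed

text \<open>A crossing edge touches the boundary at one end, so besides adjacency inside
  \<open>W\<close> the code stores how each variable relates to every boundary vertex, by equality
  and by adjacency. Sets of positions in \<open>bs\<close> keep the number of codes bounded in terms
  of \<open>length bs\<close>.\<close>

definition adj_code ::
  "'a rel_structure \<Rightarrow> 'a list \<Rightarrow> nat \<Rightarrow> nat \<Rightarrow> (nat \<Rightarrow> 'a option) \<Rightarrow> bool \<times> nat set \<times> nat set \<times> nat set \<times> nat set" where
  "adj_code M bs i j u =
     ((\<exists>x y. u i = Some x \<and> u j = Some y \<and> adj M x y),
      {d. d < length bs \<and> u i = Some (bs ! d)}, {d. d < length bs \<and> u j = Some (bs ! d)},
      {d. d < length bs \<and> (\<exists>x. u i = Some x \<and> adj M x (bs ! d))},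
      {d. d < length bs \<and> (\<exists>y. u j = Some y \<and> adj M (bs ! d) y)})"

lemma decides_Adj:
  assumes bd: "boundary M W (set bs)"
  shows "decides M W (adj_code M bs i j) (Adj i j)"
proof (rule decidesI)
  fix v v'
  assume so: "same_outside W v v'" 
    and f: "adj_code M bs i j (view W v) = adj_code M bs i j (view W v')"
    and s: "sat M v (Adj i j)"
  have in_iff: "v k \<in> W \<longleftrightarrow> v' k \<in> W" for k
    using so by (auto simp: same_outside_def)
  have out: "v k \<notin> W \<Longrightarrow> v' k = v k" for k
    using so by (auto simp: same_outside_def)
  have f1: "v i \<in> W \<Longrightarrow> v j \<in> W \<Longrightarrow> adj M (v i) (v j) = adj M (v' i) (v' j)"
    using f in_iff by (auto simp: adj_code_def view_def split: if_splits)
  have f2: "v i = b \<longleftrightarrow> v' i = b" if "b \<in> set bs" "v i \<in> W" for b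
    using f in_iff[of i] that by (auto simp: adj_code_def view_def in_set_conv_nth)
  have f3: "v j = b \<longleftrightarrow> v' j = b" if "b \<in> set bs" "v j \<in> W" for b
    using f in_iff[of j] that by (auto simp: adj_code_def view_def in_set_conv_nth)
  have f4: "adj M (v i) b \<longleftrightarrow> adj M (v' i) b" if "b \<in> set bs" "v i \<in> W" for b
    using f in_iff[of i] that by (auto simp: adj_code_def view_def in_set_conv_nth)
  have f5: "adj M b (v j) \<longleftrightarrow> adj M b (v' j)" if "b \<in> set bs" "v j \<in> W" for b
    using f in_iff[of j] that by (auto simp: adj_code_def view_def in_set_conv_nth)
  have s': "adj M (v i) (v j)" using s by simp
  consider "v i \<in> W" "v j \<in> W" | "v i \<in> W" "v j \<notin> W" | "v i \<notin> W" "v j \<in> W"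
    | "v i \<notin> W" "v j \<notin> W" by blast
  then have "adj M (v' i) (v' j)"
  proof cases
    case 1
    then show ?thesis using f1 s' by simp
  next
    case 2
    \<comment> \<open>Either the inner end is a boundary vertex, which \<open>f2\<close> makes
      \<open>v'\<close> repeat, or the outer end is one, and \<open>f4\<close> preserves adjacency
      to it.\<close>
    then have "v i \<in> set bs \<or> v j \<in> set bs" using bd s' unfolding boundary_def by blast
    then show ?thesis using f2[of "v i"] f4[of "v j"] out[of j] 2 s' by auto
  next
    case 3
    then have "v i \<in> set bs \<or> v j \<in> set bs" using bd s' unfolding boundary_def by blast
    then show ?thesis using f3[of "v j"] f5[of "v i"] out[of i] 3 s' by auto
  next
    case 4
    then show ?thesis using out s' by simp
  qed
  then show "sat M v' (Adj i j)" by simp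
qed

text \<open>A witness outside \<open>W\<close> is reused; a witness inside is replaced by one
  producing the same type. Hence the new code: the type with variable \<open>i\<close> erased, and
  the set of types reachable by placing \<open>i\<close> inside.\<close>

lemma decides_Ex:
  assumes "universe M = UNIV" and dec: "decides M W f \<phi>"
  shows "decides M W (\<lambda>u. (f (u(i := None)), (\<lambda>y. f (u(i := Some y))) ` W)) (Ex i \<phi>)"
proof (rule decidesI)
  fix v v'
  assume so: "same_outside W v v'"
    and f: "(f ((view W v)(i := None)), (\<lambda>y. f ((view W v)(i := Some y))) ` W)
          = (f ((view W v')(i := None)), (\<lambda>y. f ((view W v')(i := Some y))) ` W)"
    and s: "sat M v (Ex i \<phi>)"
  obtain a where a: "sat M (v(i := a)) \<phi>" using s by auto
  show "sat M v' (Ex i \<phi>)"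
  proof (cases "a \<in> W")
    case True
    then have "f ((view W v)(i := Some a)) \<in> (\<lambda>y. f ((view W v')(i := Some y))) ` W"
      using f by blast
    then obtain a' where a': "a' \<in> W" "f ((view W v)(i := Some a)) = f ((view W v')(i := Some a'))"
      by blast
    have "same_outside W (v(i := a)) (v'(i := a'))"
      using so True a' by (auto simp: same_outside_def)
    then have "sat M (v'(i := a')) \<phi>"
      using dec a a' True unfolding decides_def by (simp add: view_update)
    then show ?thesis using assms by auto
  next
    case False
    have "same_outside W (v(i := a)) (v'(i := a))"
      using so by (auto simp: same_outside_def)
    then have "sat M (v'(i := a)) \<phi>"
      using dec a f False unfolding decides_def by (simp add: view_update)
    then show ?thesis using assms by auto
  qed
qed

text \<open>\<open>S\<close> is fixed before \<open>W\<close> and \<open>bs\<close>, so the number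
  of types does not depend on the region. Codes are natural numbers so that the induction on
  formulas can build new codes without changing their HOL type.\<close>

definition typed_by :: "'a rel_structure \<Rightarrow> nat \<Rightarrow> fm \<Rightarrow> nat set \<Rightarrow> bool" where
  "typed_by M b \<phi> S \<longleftrightarrow> (\<forall>W bs. length bs \<le> b \<longrightarrow> boundary M W (set bs) \<longrightarrow>
     (\<exists>f. range f \<subseteq> S \<and> decides M W f \<phi>))"

lemma typed_byI:
  assumes "\<And>W bs. length bs \<le> b \<Longrightarrow> boundary M W (set bs) \<Longrightarrow> \<exists>f. range f \<subseteq> S \<and> decides M W f \<phi>"
  shows "typed_by M b \<phi> S"
  using assms unfolding typed_by_def by blast

lemma typed_byE:
  assumes "typed_by M b \<phi> S" "length bs \<le> b" "boundary M W (set bs)"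
  obtains f where "range f \<subseteq> S" "decides M W f \<phi>"
  using assms unfolding typed_by_def by blast

lemma typed_by_encode:
  fixes C :: "'c set"
  assumes "finite C"
    and "\<And>W bs. length bs \<le> b \<Longrightarrow> boundary M W (set bs) \<Longrightarrow> \<exists>f. range f \<subseteq> C \<and> decides M W f \<phi>"
  shows "\<exists>S. finite S \<and> typed_by M b \<phi> S"
proof -
  obtain h :: "'c \<Rightarrow> nat" where h: "inj_on h C"
    using finite_imp_inj_to_nat_seg[OF assms(1)] by blast
  have "typed_by M b \<phi> (h ` C)"
  proof (rule typed_byI)
    fix W bs
    assume "length bs \<le> b" "boundary M W (set bs)"
    then obtain f where f: "range f \<subseteq> C" "decides M W f \<phi>" using assms(2) by blast
    have C: "f u \<in> C" for u using f(1) by blast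
    have "decides M W (\<lambda>u. h (f u)) \<phi>"
      by (rule decides_recode[OF f(2)]) (rule inj_onD[OF h _ C C])
    moreover have "range (\<lambda>u. h (f u)) \<subseteq> h ` C" using f(1) by blast
    ultimately show "\<exists>f. range f \<subseteq> h ` C \<and> decides M W f \<phi>" by (intro exI conjI)
  qed
  then show ?thesis using assms(1) by blast
qed

text \<open>A Feferman--Vaught argument: for a fixed boundary size, the truth of \<open>\<phi>\<close> depends only on the
  part outside \<open>W\<close> and on one of finitely many types of the part inside.\<close>

lemma finitely_many_types:
  fixes M :: "'a rel_structure"
  assumes univ: "universe M = UNIV"
  shows "\<exists>S. finite S \<and> typed_by M b \<phi> S"
proof (induction \<phi>)
  case (Eq i j)
  show ?case
    by (rule typed_by_encode[of "UNIV :: bool set"]) (auto intro: decides_Eq)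
next
  case (Adj i j)
  let ?P = "Pow {..<b}"
  show ?case
  proof (rule typed_by_encode[of "(UNIV :: bool set) \<times> ?P \<times> ?P \<times> ?P \<times> ?P"])
    fix W :: "'a set" and bs
    assume bs: "length bs \<le> b" "boundary M W (set bs)"
    have "range (adj_code M bs i j) \<subseteq> UNIV \<times> ?P \<times> ?P \<times> ?P \<times> ?P"
      using bs(1) by (auto simp: adj_code_def)
    then show "\<exists>f. range f \<subseteq> (UNIV :: bool set) \<times> ?P \<times> ?P \<times> ?P \<times> ?P \<and> decides M W f (Adj i j)"
      using decides_Adj[OF bs(2)] by (intro exI conjI)
  qed simp
next
  case (Neg \<phi>)
  have "decides M W f \<phi> \<Longrightarrow> decides M W f (Neg \<phi>)" for W and f :: "(nat \<Rightarrow> 'a option) \<Rightarrow> nat"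
    by (simp add: decides_def)
  with Neg show ?case unfolding typed_by_def by meson
next
  case (Conj \<phi> \<psi>)
  obtain S1 where S1: "finite S1" "typed_by M b \<phi> S1" using Conj.IH(1) by blast
  obtain S2 where S2: "finite S2" "typed_by M b \<psi> S2" using Conj.IH(2) by blast
  show ?case
  proof (rule typed_by_encode[of "S1 \<times> S2"])
    fix W :: "'a set" and bs
    assume bs: "length bs \<le> b" "boundary M W (set bs)"
    obtain f where f: "range f \<subseteq> S1" "decides M W f \<phi>" by (rule typed_byE[OF S1(2) bs])
    obtain g where g: "range g \<subseteq> S2" "decides M W g \<psi>" by (rule typed_byE[OF S2(2) bs])
    have "decides M W (\<lambda>u. (f u, g u)) (Conj \<phi> \<psi>)"
      using f(2) g(2) unfolding decides_def prod.inject sat.simps by blast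
    moreover have "range (\<lambda>u. (f u, g u)) \<subseteq> S1 \<times> S2" using f(1) g(1) by blast
    ultimately show "\<exists>f. range f \<subseteq> S1 \<times> S2 \<and> decides M W f (Conj \<phi> \<psi>)" by (intro exI conjI)
  qed (use S1 S2 in simp)
next
  case (Ex i \<phi>)
  obtain S where S: "finite S" "typed_by M b \<phi> S" using Ex.IH by blast
  show ?case
  proof (rule typed_by_encode[of "S \<times> Pow S"])
    fix W :: "'a set" and bs
    assume bs: "length bs \<le> b" "boundary M W (set bs)"
    obtain f where f: "range f \<subseteq> S" "decides M W f \<phi>" by (rule typed_byE[OF S(2) bs])
    have "range (\<lambda>u. (f (u(i := None)), (\<lambda>y. f (u(i := Some y))) ` W)) \<subseteq> S \<times> Pow S"
      using f(1) by blast
    then show "\<exists>f. range f \<subseteq> S \<times> Pow S \<and> decides M W f (Ex i \<phi>)"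
      using decides_Ex[OF univ f(2)] by (intro exI conjI)
  qed (use S in simp)
qed

section \<open>Half-planes of the Farey graph\<close>

text \<open>In homogeneous coordinates, \<open>cone u v\<close> is one side of the Farey edge between \<open>u\<close> and \<open>v\<close>;
  both signs are needed since \<open>reduced_fraction\<close> normalises the denominator.\<close>

definition cone :: "int \<times> int \<Rightarrow> int \<times> int \<Rightarrow> rat option set" where
  "cone u v = {x. \<exists>a b. a > 0 \<and> b > 0 \<and> 
     (reduced_fraction x = (a * fst u + b * fst v, a * snd u + b * snd v) \<or>
      reduced_fraction x = (- (a * fst u + b * fst v), - (a * snd u + b * snd v)))}"

definition det :: "int \<times> int \<Rightarrow> int \<times> int \<Rightarrow> int" where
  "det u v = fst u * snd v - snd u * fst v"

definition line :: "int \<times> int \<Rightarrow> rat option set" where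
  "line u = {x. reduced_fraction x = u \<or> reduced_fraction x = (- fst u, - snd u)}"

lemma inj_reduced_fraction: "inj reduced_fraction"
proof (rule injI)
  fix x y assume e: "reduced_fraction x = reduced_fraction y"
  have "snd (quotient_of r) \<noteq> 0" for r
    using quotient_of_denom_pos'[of r] by simp
  then have "quotient_of r \<noteq> (1, 0)" for r by (metis snd_conv)
  then show "x = y" using e
    by (cases x; cases y) (auto simp: quotient_of_inject_eq dest: sym)
qed

lemma line_card: "finite (line u)" "card (line u) \<le> 2"
proof -
  let ?A = "reduced_fraction -` {u, (- fst u, - snd u)}"
  have l: "line u = ?A" by (auto simp: line_def)
  have "finite ?A" by (rule finite_vimageI[OF _ inj_reduced_fraction]) simp
  moreover have "card ?A \<le> card {u, (- fst u, - snd u)}"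
    by (rule card_inj_on_le[of reduced_fraction]) (auto intro: inj_on_subset[OF inj_reduced_fraction])
  moreover have "card {u, (- fst u, - snd u)} \<le> 2" by (simp add: card_insert_if)
  ultimately show "finite (line u)" "card (line u) \<le> 2" using l by auto
qed

lemma coprime_reduced_fraction: "coprime (fst (reduced_fraction x)) (snd (reduced_fraction x))"
  by (cases x) (auto simp: quotient_of_coprime prod.split split: prod.split)

text \<open>The coordinate sum of a point in a cone is the measure that makes repeated subdivision end.\<close>

definition depth :: "int \<times> int \<Rightarrow> int \<times> int \<Rightarrow> rat option \<Rightarrow> nat" where
  "depth u v x = nat (\<bar>det u (reduced_fraction x)\<bar> + \<bar>det (reduced_fraction x) v\<bar>)"

text \<open>Cramer's rule: for \<open>det u v = 1\<close> the two determinants in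
  \<open>depth\<close> are the coefficients of \<open>x\<close> up to sign.\<close>

lemma depth_cone:
  assumes "det u v = 1" "a > 0" "b > 0"
    "reduced_fraction x = (a * fst u + b * fst v, a * snd u + b * snd v) \<or>
      reduced_fraction x = (- (a * fst u + b * fst v), - (a * snd u + b * snd v))"
  shows "depth u v x = nat (a + b)"
proof -
  have "fst u * (a * snd u + b * snd v) - snd u * (a * fst u + b * fst v) = b * det u v"
    by (simp add: det_def algebra_simps)
  then have 1: "fst u * (a * snd u + b * snd v) - snd u * (a * fst u + b * fst v) = b"
    using assms(1) by simp
  have "(a * fst u + b * fst v) * snd v - (a * snd u + b * snd v) * fst v = a * det u v"
    by (simp add: det_def algebra_simps)
  then have 2: "(a * fst u + b * fst v) * snd v - (a * snd u + b * snd v) * fst v = a"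
    using assms(1) by simp
  have "det u (reduced_fraction x) = b \<or> det u (reduced_fraction x) = - b"
    using 1 assms(4) by (auto simp: det_def algebra_simps)
  then have "\<bar>det u (reduced_fraction x)\<bar> = b" using assms(3) by auto
  moreover have "det (reduced_fraction x) v = a \<or> det (reduced_fraction x) v = - a"
    using 2 assms(4) by (auto simp: det_def algebra_simps)
  then have "\<bar>det (reduced_fraction x) v\<bar> = a" using assms(2) by auto
  ultimately show ?thesis by (simp add: depth_def add.commute)
qed

abbreviation mediant :: "int \<times> int \<Rightarrow> int \<times> int \<Rightarrow> int \<times> int" where
  "mediant u v \<equiv> (fst u + fst v, snd u + snd v)"

lemma det_mediant [simp]: "det u (mediant u v) = det u v" "det (mediant u v) v = det u v"
  by (simp_all add: det_def algebra_simps)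

text \<open>A Stern-Brocot step, that is a subtraction of Euclid's algorithm: the smaller
  coefficient is taken away from the larger one. Equal coefficients divide a coprime pair, so they
  are 1 and the point is the mediant.\<close>

lemma cone_split:
  "cone u v \<subseteq> line (mediant u v) \<union> cone u (mediant u v) \<union> cone (mediant u v) v"
proof
  fix x assume "x \<in> cone u v"
  then obtain a b where ab: "a > 0" "b > 0" and x: "reduced_fraction x = (a * fst u + b * fst v, a * snd u + b * snd v) \<or>
      reduced_fraction x = (- (a * fst u + b * fst v), - (a * snd u + b * snd v))"
    by (auto simp: cone_def)
  consider "a = b" | "a > b" | "a < b" by linarith
  then show "x \<in> line (mediant u v) \<union> cone u (mediant u v) \<union> cone (mediant u v) v"
  proof cases
    case 1
    have x1: "reduced_fraction x = (a * (fst u + fst v), a * (snd u + snd v)) \<or>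
        reduced_fraction x = (a * - (fst u + fst v), a * - (snd u + snd v))"
      using x 1 by (simp add: algebra_simps)
    then have "a dvd fst (reduced_fraction x)" "a dvd snd (reduced_fraction x)"
      by (metis fst_conv snd_conv dvd_triv_left)+
    then have "a dvd 1" using coprime_reduced_fraction[of x] coprime_common_divisor by blast
    then have "a = 1" using ab by simp
    then show ?thesis using x 1 by (auto simp: line_def)
  next
    case 2
    then have "x \<in> cone u (mediant u v)"
      using x ab unfolding cone_def mem_Collect_eq
      by (intro exI[of _ "a - b"] exI[of _ b]) (simp add: algebra_simps)
    then show ?thesis by blast
  next
    case 3
    then have "x \<in> cone (mediant u v) v"
      using x ab unfolding cone_def mem_Collect_eq
      by (intro exI[of _ a] exI[of _ "b - a"]) (simp add: algebra_simps)
    then show ?thesis by blast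
  qed
qed

text \<open>Coefficients \<open>(a, b)\<close> with respect to the half become
  \<open>(a + b, b)\<close> with respect to the whole cone.\<close>

lemma cone_sub_left:
  assumes "x \<in> cone u (mediant u v)" "det u v = 1"
  shows "x \<in> cone u v" "depth u (mediant u v) x < depth u v x"
proof -
  obtain a b where ab: "a > 0" "b > 0" and x: "reduced_fraction x = (a * fst u + b * fst (mediant u v), a * snd u + b * snd (mediant u v)) \<or>
      reduced_fraction x = (- (a * fst u + b * fst (mediant u v)), - (a * snd u + b * snd (mediant u v)))"
    using assms by (auto simp: cone_def)
  have x': "reduced_fraction x = ((a + b) * fst u + b * fst v, (a + b) * snd u + b * snd v) \<or>
      reduced_fraction x = (- ((a + b) * fst u + b * fst v), - ((a + b) * snd u + b * snd v))"
    using x by (simp add: algebra_simps)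
  have "a + b > 0" using ab by simp
  then show "x \<in> cone u v" using x' ab unfolding cone_def by blast
  have "depth u v x = nat ((a + b) + b)"
    by (rule depth_cone) (use assms ab x' in auto)
  moreover have "depth u (mediant u v) x = nat (a + b)"
    by (rule depth_cone) (use assms ab x in auto)
  ultimately show "depth u (mediant u v) x < depth u v x" using ab by simp
qed

lemma cone_sub_right:
  assumes "x \<in> cone (mediant u v) v" "det u v = 1"
  shows "x \<in> cone u v" "depth (mediant u v) v x < depth u v x"
proof -
  obtain a b where ab: "a > 0" "b > 0" and x: "reduced_fraction x = (a * fst (mediant u v) + b * fst v, a * snd (mediant u v) + b * snd v) \<or>
      reduced_fraction x = (- (a * fst (mediant u v) + b * fst v), - (a * snd (mediant u v) + b * snd v))"
    using assms by (auto simp: cone_def)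
  have x': "reduced_fraction x = (a * fst u + (a + b) * fst v, a * snd u + (a + b) * snd v) \<or>
      reduced_fraction x = (- (a * fst u + (a + b) * fst v), - (a * snd u + (a + b) * snd v))"
    using x by (simp add: algebra_simps)
  have "a + b > 0" using ab by simp
  then show "x \<in> cone u v" using x' ab unfolding cone_def by blast
  have "depth u v x = nat (a + (a + b))"
    by (rule depth_cone) (use assms ab x' in auto)
  moreover have "depth (mediant u v) v x = nat (a + b)"
    by (rule depth_cone) (use assms ab x in auto)
  ultimately show "depth (mediant u v) v x < depth u v x" using ab by simp
qed

text \<open>Descent: while one half still contains all of \<open>X\<close>, passing to it lowers the
  depth of a fixed point of \<open>X\<close>. The last two conclusions provide a point of
  \<open>X\<close> outside either half.\<close>

lemma smallest_cone:
  assumes "X \<subseteq> cone u v" "det u v = 1" "X \<noteq> {}"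
  obtains u' v' where "det u' v' = 1" "cone u' v' \<subseteq> cone u v" "X \<subseteq> cone u' v'"
    "\<not> X \<subseteq> cone u' (mediant u' v')" "\<not> X \<subseteq> cone (mediant u' v') v'"
proof -
  obtain x where x: "x \<in> X" using assms by blast
  have "\<exists>u' v'. det u' v' = 1 \<and> cone u' v' \<subseteq> cone u v \<and> X \<subseteq> cone u' v' \<and>
    \<not> X \<subseteq> cone u' (mediant u' v') \<and> \<not> X \<subseteq> cone (mediant u' v') v'"
    using assms(1,2)
  proof (induction "depth u v x" arbitrary: u v rule: less_induct)
    case less
    have L: "cone u (mediant u v) \<subseteq> cone u v" and R: "cone (mediant u v) v \<subseteq> cone u v"
      using cone_sub_left cone_sub_right less.prems by blast+
    consider "X \<subseteq> cone u (mediant u v)" | "X \<subseteq> cone (mediant u v) v"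
      | "\<not> X \<subseteq> cone u (mediant u v)" "\<not> X \<subseteq> cone (mediant u v) v" by blast
    then show ?case
    proof cases
      case 1
      have "depth u (mediant u v) x < depth u v x"
        using cone_sub_left(2) 1 x less.prems by blast
      with less.hyps[OF _ 1] less.prems(2) obtain u' v' where "det u' v' = 1" "cone u' v' \<subseteq> cone u (mediant u v)"
        "X \<subseteq> cone u' v'" "\<not> X \<subseteq> cone u' (mediant u' v')" "\<not> X \<subseteq> cone (mediant u' v') v'"
        by (metis det_mediant(1))
      then show ?thesis using L by blast
    next
      case 2
      have "depth (mediant u v) v x < depth u v x"
        using cone_sub_right(2) 2 x less.prems by blast
      with less.hyps[OF _ 2] less.prems(2) obtain u' v' where "det u' v' = 1" "cone u' v' \<subseteq> cone (mediant u v) v"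
        "X \<subseteq> cone u' v'" "\<not> X \<subseteq> cone u' (mediant u' v')" "\<not> X \<subseteq> cone (mediant u' v') v'"
        by (metis det_mediant(2))
      then show ?thesis using R by blast
    next
      case 3
      then show ?thesis using less.prems by blast
    qed
  qed
  then show thesis using that by blast
qed

lemma farey_adj_det: "farey_adj x y \<Longrightarrow> \<bar>det (reduced_fraction x) (reduced_fraction y)\<bar> = 1"
  by (auto simp: farey_adj_def det_def split: prod.splits)

lemma farey_adj_sym: "farey_adj x y \<Longrightarrow> farey_adj y x"
  by (auto simp: farey_adj_def algebra_simps abs_minus_commute split: prod.splits)

text \<open>In the basis \<open>u, v\<close> a neighbour \<open>(c, d)\<close> of the point
  \<open>(a, b)\<close> satisfies \<open>|a * d - b * c| = 1\<close>. Nonzero \<open>c\<close>,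
  \<open>d\<close> of equal sign put it into the cone, of opposite sign make the left side at least
  2; so one of them vanishes and the other is 1 or -1. This is the separation property of a Farey
  edge.\<close>

lemma boundary_cone:
  assumes uv: "det u v = 1"
  shows "boundary farey_graph (cone u v) (line u \<union> line v)"
proof -
  have "y \<in> line u \<union> line v" if x: "x \<in> cone u v" and y: "y \<notin> cone u v" and adj: "farey_adj x y" for x y
  proof -
    obtain a b where ab: "a > 0" "b > 0" and x: "reduced_fraction x = (a * fst u + b * fst v, a * snd u + b * snd v) \<or>
        reduced_fraction x = (- (a * fst u + b * fst v), - (a * snd u + b * snd v))"
      using x by (auto simp: cone_def)
    define c where "c = det (reduced_fraction y) v"
    define d where "d = det u (reduced_fraction y)"
    have yf: "fst (reduced_fraction y) = c * fst u + d * fst v"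
    proof -
      have "c * fst u + d * fst v = fst (reduced_fraction y) * det u v"
        by (simp add: c_def d_def det_def algebra_simps)
      then show ?thesis using uv by simp
    qed
    have ys: "snd (reduced_fraction y) = c * snd u + d * snd v"
    proof -
      have "c * snd u + d * snd v = snd (reduced_fraction y) * det u v"
        by (simp add: c_def d_def det_def algebra_simps)
      then show ?thesis using uv by simp
    qed
    have y_eq: "reduced_fraction y = (c * fst u + d * fst v, c * snd u + d * snd v)"
      using yf ys by (metis prod.collapse)
    have "(a * fst u + b * fst v) * (c * snd u + d * snd v) - (a * snd u + b * snd v) * (c * fst u + d * fst v)
        = (a * d - b * c) * det u v"
      by (simp add: det_def algebra_simps)
    then have "\<bar>det (reduced_fraction x) (reduced_fraction y)\<bar> = \<bar>a * d - b * c\<bar>"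
      using x y_eq uv by (auto simp: det_def algebra_simps)
    with adj have one: "\<bar>a * d - b * c\<bar> = 1" using farey_adj_det by metis
    have not_pos: "\<not> (c > 0 \<and> d > 0)" using y y_eq by (auto simp: cone_def)
    have not_neg: "\<not> (c < 0 \<and> d < 0)"
    proof
      assume n: "c < 0 \<and> d < 0"
      have "y \<in> cone u v" unfolding cone_def mem_Collect_eq
        by (rule exI[of _ "- c"], rule exI[of _ "- d"]) (use n y_eq in auto)
      then show False using y by blast
    qed
    have not_mixed: "\<not> (c > 0 \<and> d < 0)"
    proof
      assume cd: "c > 0 \<and> d < 0"
      then have "a * (- d) > 0" "b * c > 0"
        using ab by (simp_all only: mult_pos_pos neg_0_less_iff_less)
      then show False using one by simp
    qed
    have not_mixed': "\<not> (c < 0 \<and> d > 0)"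
    proof
      assume cd: "c < 0 \<and> d > 0"
      then have "a * d > 0" "b * (- c) > 0"
        using ab by (simp_all only: mult_pos_pos neg_0_less_iff_less)
      then show False using one by simp
    qed
    have "c = 0 \<or> d = 0" using not_pos not_neg not_mixed not_mixed' by linarith
    then show ?thesis
    proof
      assume "c = 0"
      then have "\<bar>d * a\<bar> = 1" using one by (simp add: mult.commute)
      then have "d = 1 \<or> d = -1" using abs_zmult_eq_1[of d a] by linarith
      then show ?thesis using y_eq \<open>c = 0\<close> by (auto simp: line_def)
    next
      assume "d = 0"
      then have "\<bar>c * b\<bar> = 1" using one by (simp add: mult.commute)
      then have "c = 1 \<or> c = -1" using abs_zmult_eq_1[of c b] by linarith
      then show ?thesis using y_eq \<open>d = 0\<close> by (auto simp: line_def)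
    qed
  qed
  then show ?thesis using farey_adj_sym
    unfolding boundary_def by (auto simp: farey_graph_def)
qed

section \<open>Chains of half-planes\<close>

text \<open>The direction of inclusion may vary from pair to pair; it becomes uniform only after
  Ramsey's theorem, in \<open>cases_coordinate\<close>.\<close>

definition chain_sets :: "'i set \<Rightarrow> ('i \<Rightarrow> 'a) \<Rightarrow> ('i \<Rightarrow> 'a set) \<Rightarrow> bool" where
  "chain_sets F y H \<longleftrightarrow> (\<forall>i\<in>F. y i \<in> H i) \<and>
     (\<forall>i\<in>F. \<forall>j\<in>F. i \<noteq> j \<longrightarrow> (H i \<subseteq> H j \<and> y j \<notin> H i) \<or> (H j \<subseteq> H i \<and> y i \<notin> H j))"

lemma chain_sets_reindex:
  assumes "chain_sets (e ` F) y H" "inj_on e F"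
  shows "chain_sets F (\<lambda>i. y (e i)) (\<lambda>i. H (e i))"
  unfolding chain_sets_def
proof (intro conjI ballI impI)
  fix i assume "i \<in> F"
  then show "y (e i) \<in> H (e i)" using assms(1) unfolding chain_sets_def by blast
next
  fix i j assume ij: "i \<in> F" "j \<in> F" "i \<noteq> j"
  then have "e i \<in> e ` F" "e j \<in> e ` F" "e i \<noteq> e j" using assms(2) by (auto simp: inj_on_def)
  then show "(H (e i) \<subseteq> H (e j) \<and> y (e j) \<notin> H (e i)) \<or> (H (e j) \<subseteq> H (e i) \<and> y (e i) \<notin> H (e j))"
    using assms(1) unfolding chain_sets_def by meson
qed

definition is_cone :: "rat option set \<Rightarrow> bool" where
  "is_cone H \<longleftrightarrow> (\<exists>u v. det u v = 1 \<and> H = cone u v)"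

text \<open>The smallest cone around \<open>X\<close> is attached to a point missed by its richer
  half, and the construction continues in that half. The new point then lies outside all smaller
  cones.\<close>

lemma chain_in_cone:
  assumes "finite X" "X \<subseteq> cone u v" "det u v = 1" "3 ^ T \<le> card X"
  shows "\<exists>F H. F \<subseteq> X \<and> card F = T \<and> chain_sets F (\<lambda>x. x) H \<and> (\<forall>x\<in>F. is_cone (H x) \<and> H x \<subseteq> cone u v)"
  using assms
proof (induction T arbitrary: X u v)
  case 0
  then show ?case by (intro exI[of _ "{}"]) (simp add: chain_sets_def)
next
  case (Suc T)
  have "X \<noteq> {}" using Suc.prems(4) by auto
  then obtain u' v' where uv: "det u' v' = 1" "cone u' v' \<subseteq> cone u v" "X \<subseteq> cone u' v'"
    and no: "\<not> X \<subseteq> cone u' (mediant u' v')" "\<not> X \<subseteq> cone (mediant u' v') v'"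
    using smallest_cone Suc.prems(2,3) by blast
  let ?m = "mediant u' v'"
  have sub: "cone u' ?m \<subseteq> cone u' v'" "cone ?m v' \<subseteq> cone u' v'"
    using cone_sub_left cone_sub_right uv(1) by blast+
  have "X \<subseteq> line ?m \<union> (X \<inter> cone u' ?m) \<union> (X \<inter> cone ?m v')"
    using uv(3) cone_split by fastforce
  then have "card X \<le> card (line ?m \<union> (X \<inter> cone u' ?m) \<union> (X \<inter> cone ?m v'))"
    by (rule card_mono[rotated]) (use Suc.prems(1) line_card in auto)
  also have "\<dots> \<le> card (line ?m) + card (X \<inter> cone u' ?m) + card (X \<inter> cone ?m v')"
    by (meson card_Un_le add_le_mono1 order_trans)
  finally have "3 ^ Suc T \<le> 2 + card (X \<inter> cone u' ?m) + card (X \<inter> cone ?m v')"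
    using line_card(2)[of ?m] Suc.prems(4) by linarith
  \<comment> \<open>If both halves had fewer than \<open>3 ^ T\<close> points, the total would be at
    most \<open>2 * 3 ^ T\<close>, which is below \<open>3 ^ Suc T\<close>.\<close>
  then have "3 ^ T \<le> card (X \<inter> cone u' ?m) \<or> 3 ^ T \<le> card (X \<inter> cone ?m v')"
    by simp linarith
  then obtain p q where pq: "det p q = 1" "3 ^ T \<le> card (X \<inter> cone p q)" "\<not> X \<subseteq> cone p q"
    "cone p q \<subseteq> cone u' v'"
    using no sub uv(1) det_mediant by metis
  obtain F H where F: "F \<subseteq> X \<inter> cone p q" "card F = T" "chain_sets F (\<lambda>x. x) H"
    "\<forall>x\<in>F. is_cone (H x) \<and> H x \<subseteq> cone p q"
    using Suc.IH[of "X \<inter> cone p q" p q] pq Suc.prems(1) by auto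
  obtain x where x: "x \<in> X" "x \<notin> cone p q" using pq(3) by blast
  then have xF: "x \<notin> F" using F(1) by blast
  have finF: "finite F" using F(1) Suc.prems(1) by (meson finite_Int finite_subset)
  let ?H = "H(x := cone u' v')"
  have "chain_sets (insert x F) (\<lambda>x. x) ?H"
    using F(3,4) x xF uv(3) pq(4) unfolding chain_sets_def by (auto split: if_splits)
  moreover have "is_cone (cone u' v')" using uv(1) unfolding is_cone_def by blast
  then have "\<forall>y\<in>insert x F. is_cone (?H y) \<and> ?H y \<subseteq> cone u v"
    using F(4) uv(2) pq(4) \<open>is_cone (cone u' v')\<close> by (metis fun_upd_apply insert_iff subset_trans)
  moreover have "insert x F \<subseteq> X" "card (insert x F) = Suc T"
    using x F xF finF by auto
  ultimately show ?case by (intro exI conjI)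
qed

text \<open>The edge between infinity and 0 separates positive from negative rationals;
  \<open>(-1, 0)\<close> represents infinity with the sign that makes the second determinant
  1.\<close>

lemma cover_by_cones: "UNIV = line (1, 0) \<union> line (0, 1) \<union> cone (1, 0) (0, 1) \<union> cone (0, 1) (-1, 0)"
proof -
  have "x \<in> line (1, 0) \<union> line (0, 1) \<union> cone (1, 0) (0, 1) \<union> cone (0, 1) (-1, 0)" for x
  proof -
    obtain p q where pq: "reduced_fraction x = (p, q)" by fastforce
    have "q \<ge> 0" using quotient_of_denom_pos pq by (cases x) (auto dest: less_imp_le)
    moreover have cop: "coprime p q" using coprime_reduced_fraction[of x] pq by simp
    ultimately consider "p = 0" | "q = 0" | "p > 0" "q > 0" | "p < 0" "q > 0" by linarith
    then show ?thesis
    proof cases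
      case 1
      then have "q = 1 \<or> q = -1" using cop by auto
      then show ?thesis using pq 1 by (auto simp: line_def)
    next
      case 2
      then have "p = 1 \<or> p = -1" using cop by auto
      then show ?thesis using pq 2 by (auto simp: line_def)
    next
      case 3
      then show ?thesis using pq by (auto simp: cone_def)
    next
      case 4
      have "x \<in> cone (0, 1) (-1, 0)" unfolding cone_def mem_Collect_eq
        by (rule exI[of _ q], rule exI[of _ "- p"]) (use 4 pq in auto)
      then show ?thesis by blast
    qed
  qed
  then show ?thesis by blast
qed

text \<open>The summand 4 pays for the two lines of \<open>cover_by_cones\<close>, at most 2
  vertices each, and the factor 2 for the two half-planes.\<close>

lemma chain_of_points:
  assumes "finite X" "4 + 2 * 3 ^ T \<le> card X"
  shows "\<exists>F H. F \<subseteq> X \<and> card F = T \<and> chain_sets F (\<lambda>x. x) H \<and> (\<forall>x\<in>F. is_cone (H x))"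
proof -
  let ?L = "line (1, 0) \<union> line (0, 1)"
  let ?A = "X \<inter> cone (1, 0) (0, 1)" and ?B = "X \<inter> cone (0, 1) (-1, 0)"
  have "X \<subseteq> ?L \<union> ?A \<union> ?B" using cover_by_cones by blast
  then have "card X \<le> card (?L \<union> ?A \<union> ?B)"
    by (rule card_mono[rotated]) (use assms(1) line_card in auto)
  also have "\<dots> \<le> card ?L + card ?A + card ?B"
    by (meson card_Un_le add_le_mono1 order_trans)
  finally have "card X \<le> card ?L + card ?A + card ?B" .
  moreover have "card ?L \<le> 4"
    using card_Un_le[of "line (1, 0)" "line (0, 1)"] line_card(2)[of "(1, 0)"] line_card(2)[of "(0, 1)"]
    by linarith
  ultimately have "3 ^ T \<le> card ?A \<or> 3 ^ T \<le> card ?B"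
    using assms(2) by linarith
  moreover have "det (1, 0) (0, 1) = 1" "det (0, 1) (-1, 0) = 1" by (simp_all add: det_def)
  ultimately obtain p q where pq: "det p q = 1" "3 ^ T \<le> card (X \<inter> cone p q)" by blast
  have "finite (X \<inter> cone p q)" "X \<inter> cone p q \<subseteq> cone p q" using assms(1) by auto
  from chain_in_cone[OF this pq] obtain F H where F: "F \<subseteq> X \<inter> cone p q" "card F = T"
    "chain_sets F (\<lambda>x. x) H" "\<forall>x\<in>F. is_cone (H x) \<and> H x \<subseteq> cone p q" by (elim exE conjE)
  then have "F \<subseteq> X" "\<forall>x\<in>F. is_cone (H x)" by simp_all
  with F(2,3) show ?thesis by (intro exI conjI)
qed

text \<open>For a constant family the cut sets are irrelevant and taken to be empty.\<close>

definition cut_family :: "'i set \<Rightarrow> ('i \<Rightarrow> rat option) \<Rightarrow> ('i \<Rightarrow> rat option set) \<Rightarrow> bool" where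
  "cut_family F y H \<longleftrightarrow> 
     (\<forall>i\<in>F. \<forall>j\<in>F. y i = y j) \<and> (\<forall>i\<in>F. H i = {}) \<or>
     chain_sets F y H \<and> (\<forall>i\<in>F. is_cone (H i))"

lemma cut_family_subset: "cut_family F y H \<Longrightarrow> F' \<subseteq> F \<Longrightarrow> cut_family F' y H"
  unfolding cut_family_def chain_sets_def by (meson subset_iff)

lemma cut_family_reindex:
  assumes "cut_family (e ` F) y H" "inj_on e F"
  shows "cut_family F (\<lambda>i. y (e i)) (\<lambda>i. H (e i))"
  using assms chain_sets_reindex unfolding cut_family_def by (metis imageI)

text \<open>Either some value is taken by \<open>T\<close> indices, or there are at least
  \<open>4 + 2 * 3 ^ T\<close> distinct values, which yield a chain.\<close>

lemma cut_family_exists: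
  assumes "finite I" "T * (4 + 2 * 3 ^ T) \<le> card I"
  shows "\<exists>F H. F \<subseteq> I \<and> card F = T \<and> cut_family F y H"
proof (cases "\<exists>x. T \<le> card {i \<in> I. y i = x}")
  case True
  then obtain x where "T \<le> card {i \<in> I. y i = x}" by blast
  then obtain F where F: "F \<subseteq> {i \<in> I. y i = x}" "card F = T"
    by (meson obtain_subset_with_card_n)
  then have "cut_family F y (\<lambda>_. {})" unfolding cut_family_def by blast
  then show ?thesis using F by blast
next
  case False
  have "card I = (\<Sum>x\<in>y ` I. card {i \<in> I. y i = x})"
    using sum.image_gen[OF assms(1), of "\<lambda>_. 1 :: nat" y] by simp
  also have "\<dots> \<le> (\<Sum>x\<in>y ` I. T)"
    by (rule sum_mono) (use False in \<open>auto simp: not_le dest: less_imp_le\<close>)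
  also have "\<dots> = T * card (y ` I)" by simp
  finally have "T * (4 + 2 * 3 ^ T) \<le> T * card (y ` I)" using assms(2) by linarith
  show ?thesis
  proof (cases "T = 0")
    case True
    then show ?thesis by (intro exI[of _ "{}"]) (simp add: cut_family_def)
  next
    case False
    with \<open>T * (4 + 2 * 3 ^ T) \<le> T * card (y ` I)\<close> have "4 + 2 * 3 ^ T \<le> card (y ` I)" by simp
    then obtain X H where X: "X \<subseteq> y ` I" "card X = T" "chain_sets X (\<lambda>x. x) H" "\<forall>x\<in>X. is_cone (H x)"
      using chain_of_points[of "y ` I" T] assms(1) by blast
    obtain F where F: "F \<subseteq> I" "inj_on y F" "X = y ` F"
      using X(1) by (meson subset_image_inj)
    have "chain_sets F y (\<lambda>i. H (y i))"
      using chain_sets_reindex[of y F "\<lambda>x. x" H] X(3) F(2,3) by simp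
    then have "cut_family F y (\<lambda>i. H (y i))"
      using X(4) F(3) unfolding cut_family_def by blast
    moreover have "card F = T" using X(2) F(2,3) by (simp add: card_image)
    ultimately show ?thesis using F(1) by blast
  qed
qed

text \<open>Coordinates are thinned one after another; the induction hypothesis is applied to the
  larger size that the last coordinate requires. That \<open>N\<close> is independent of
  \<open>x\<close> is what later allows a first-order formulation.\<close>

lemma cut_families_exist:
  "\<exists>N. \<forall>I (x :: 'i \<Rightarrow> nat \<Rightarrow> rat option). finite I \<longrightarrow> N \<le> card I \<longrightarrow>
     (\<exists>F H. F \<subseteq> I \<and> card F = T \<and> (\<forall>k<n. cut_family F (\<lambda>i. x i k) (H k)))"
proof (induction n arbitrary: T)
  case 0
  show ?case by (meson obtain_subset_with_card_n not_less_zero)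
next
  case (Suc n)
  let ?T = "T * (4 + 2 * 3 ^ T)"
  obtain N where N: "\<And>I (x :: 'i \<Rightarrow> nat \<Rightarrow> rat option). finite I \<Longrightarrow> N \<le> card I \<Longrightarrow>
     \<exists>F H. F \<subseteq> I \<and> card F = ?T \<and> (\<forall>k<n. cut_family F (\<lambda>i. x i k) (H k))"
    using Suc.IH[of ?T] by blast
  have "\<exists>F H. F \<subseteq> I \<and> card F = T \<and> (\<forall>k<Suc n. cut_family F (\<lambda>i. x i k) (H k))"
    if I: "finite I" "N \<le> card I" for I and x :: "'i \<Rightarrow> nat \<Rightarrow> rat option"
  proof -
    obtain F H where F: "F \<subseteq> I" "card F = ?T" "\<forall>k<n. cut_family F (\<lambda>i. x i k) (H k)"
      using N[OF I] by blast
    have "finite F" using F(1) I(1) finite_subset by blast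
    then obtain F' H' where F': "F' \<subseteq> F" "card F' = T" "cut_family F' (\<lambda>i. x i n) H'"
      using cut_family_exists[of F T "\<lambda>i. x i n"] F(2) by auto
    have "cut_family F' (\<lambda>i. x i k) ((H(n := H')) k)" if "k < Suc n" for k
    proof (cases "k = n")
      case True
      then show ?thesis using F'(3) by simp
    next
      case False
      then have "cut_family F (\<lambda>i. x i k) (H k)" using that F(3) by simp
      then show ?thesis using False cut_family_subset[OF _ F'(1)] by simp
    qed
    then have "\<forall>k<Suc n. cut_family F' (\<lambda>i. x i k) ((H(n := H')) k)" by blast
    moreover have "F' \<subseteq> I" using F(1) F'(1) by blast
    ultimately show ?thesis using F'(2) by (intro exI conjI)
  qed
  then show ?case by blast
qed

text \<open>The colouring \<open>c\<close> need not be symmetric: \<open>F\<close> is enumerated by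
  \<open>g\<close> and a pair is coloured in the order of its positions, so homogeneity is claimed
  for \<open>s < t\<close> only.\<close>

lemma ramsey_pairs:
  fixes C :: "'c set" and T :: nat
  shows "\<exists>N. \<forall>F :: nat set. \<forall>c. finite F \<longrightarrow> N \<le> card F \<longrightarrow> (\<forall>s t. c s t \<in> C) \<longrightarrow> finite C \<longrightarrow>
     (\<exists>e col. inj_on e {..<T} \<and> e ` {..<T} \<subseteq> F \<and> (\<forall>s t. s < t \<longrightarrow> t < T \<longrightarrow> c (e s) (e t) = col))"
proof (cases "finite C")
  case True
  define m :: nat where "m = card C"
  obtain h where h: "bij_betw h C {..<m}"
    using ex_bij_betw_finite_nat[OF True] unfolding m_def by (metis atLeast0LessThan)
  obtain N :: nat where N: "partn_lst {..<N} (replicate m T) 2"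
    using ramsey_full by blast
  have "\<exists>e col. inj_on e {..<T} \<and> e ` {..<T} \<subseteq> F \<and> (\<forall>s t. s < t \<longrightarrow> t < T \<longrightarrow> c (e s) (e t) = col)"
    if F: "finite F" "N \<le> card F" and c: "\<forall>s t. c s t \<in> C" for F :: "nat set" and c
  proof -
    obtain g where g: "bij_betw g {..<card F} F"
      using ex_bij_betw_nat_finite[OF F(1)] by (metis atLeast0LessThan)
    define f where "f P = h (c (g (Min P)) (g (Max P)))" for P
    have "f \<in> nsets {..<N} 2 \<rightarrow> {..<m}"
      using c h by (auto simp: f_def dest: bij_betwE)
    then obtain i H where i: "i < m" and H: "H \<in> nsets {..<N} (replicate m T ! i)"
      and mono: "f ` nsets H 2 \<subseteq> {i}"
      using partn_lstE[OF N, of f m] unfolding monochromatic_def by auto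
    have H: "H \<subseteq> {..<N}" "finite H" "card H = T"
      using H i by (auto simp: nsets_def)
    define e where "e s = sorted_list_of_set H ! s" for s
    have len: "length (sorted_list_of_set H) = T" using H by simp
    have eH: "e s \<in> H" if "s < T" for s
      using that len H(2) unfolding e_def by (metis nth_mem set_sorted_list_of_set)
    have less: "e s < e t" if "s < t" "t < T" for s t
      using that len strict_sorted_list_of_set[of H] unfolding e_def by (simp add: sorted_wrt_iff_nth_less)
    have inj_e: "inj_on e {..<T}"
      using less by (metis inj_onI lessThan_iff linorder_neqE_nat less_irrefl)
    have inj_g: "inj_on g H"
      using g H(1) F(2) by (meson bij_betw_imp_inj_on inj_on_subset lessThan_subset_iff subset_trans)
    have "inj_on (\<lambda>s. g (e s)) {..<T}"
      using inj_e inj_g eH by (auto simp: inj_on_def)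
    moreover have "(\<lambda>s. g (e s)) ` {..<T} \<subseteq> F"
      using eH H(1) F(2) g by (fastforce dest: bij_betwE)
    moreover have "c (g (e s)) (g (e t)) = inv_into C h i" if st: "s < t" "t < T" for s t
    proof -
      have "{e s, e t} \<in> nsets H 2"
        using less[OF st] eH st by (auto simp: nsets_def)
      then have "f {e s, e t} = i" using mono by blast
      then have "h (c (g (e s)) (g (e t))) = i"
        using less[OF st] by (simp add: f_def)
      then show ?thesis using c h by (metis bij_betw_inv_into_left)
    qed
    ultimately show ?thesis by (intro exI[of _ "\<lambda>s. g (e s)"] exI[of _ "inv_into C h i"]) simp
  qed
  then show ?thesis by blast
qed simp

section \<open>Exchanging twins\<close>

lemma cone_boundary:
  assumes "is_cone H \<or> H = {}"
  shows "\<exists>B. finite B \<and> card B \<le> 4 \<and> boundary farey_graph H B"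
proof (cases "H = {}")
  case True
  then show ?thesis by (intro exI[of _ "{}"]) (simp add: boundary_def)
next
  case False
  then obtain u v where uv: "det u v = 1" "H = cone u v" using assms unfolding is_cone_def by blast
  have "card (line u \<union> line v) \<le> 4"
    using card_Un_le[of "line u" "line v"] line_card(2)[of u] line_card(2)[of v] by linarith
  then show ?thesis using boundary_cone[OF uv(1)] line_card(1) uv(2) by (meson finite_UnI)
qed

lemma farey_adj_iff: "adj farey_graph x y \<longleftrightarrow> farey_adj x y"
  by (simp add: farey_graph_def)

text \<open>An edge that leaves a symmetric difference changes membership in one of its two sets,
  and so meets the boundary of that set.\<close>

lemma boundary_symdiff_Union:
  assumes "\<And>k. k \<in> K \<Longrightarrow> boundary farey_graph (A k) (B k)" "\<And>k. k \<in> K \<Longrightarrow> boundary farey_graph (A' k) (B' k)"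
  shows "boundary farey_graph (\<Union>k\<in>K. (A k - A' k) \<union> (A' k - A k)) (\<Union>k\<in>K. B k \<union> B' k)"
proof -
  have A: "x \<in> B k \<or> y \<in> B k" if "k \<in> K" "(x \<in> A k) \<noteq> (y \<in> A k)" "farey_adj x y" for x y k
    using assms(1)[OF that(1)] that farey_adj_sym unfolding boundary_def farey_adj_iff by blast
  have A': "x \<in> B' k \<or> y \<in> B' k" if "k \<in> K" "(x \<in> A' k) \<noteq> (y \<in> A' k)" "farey_adj x y" for x y k
    using assms(2)[OF that(1)] that farey_adj_sym unfolding boundary_def farey_adj_iff by blast
  show ?thesis
    unfolding boundary_def farey_adj_iff
  proof (intro ballI allI impI)
    fix x y
    assume x: "x \<in> (\<Union>k\<in>K. (A k - A' k) \<union> (A' k - A k))" and y: "y \<notin> (\<Union>k\<in>K. (A k - A' k) \<union> (A' k - A k))"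
      and "farey_adj x y \<or> farey_adj y x"
    then have adj: "farey_adj x y" using farey_adj_sym by blast
    obtain k where k: "k \<in> K" "(x \<in> A k) \<noteq> (x \<in> A' k)" using x by blast
    then have "(y \<in> A k) = (y \<in> A' k)" using y by blast
    then have "(x \<in> A k) \<noteq> (y \<in> A k) \<or> (x \<in> A' k) \<noteq> (y \<in> A' k)" using k(2) by blast
    then show "x \<in> (\<Union>k\<in>K. B k \<union> B' k) \<or> y \<in> (\<Union>k\<in>K. B k \<union> B' k)"
      using A[OF k(1) _ adj] A'[OF k(1) _ adj] k(1) by blast
  qed
qed

text \<open>The blocks hold the factors; \<open>w\<close> stands for everything else, namely the
  product, the unit and the parameters.\<close>

definition fill :: "nat \<Rightarrow> nat \<Rightarrow> (nat \<Rightarrow> nat \<Rightarrow> 'a) \<Rightarrow> (nat \<Rightarrow> nat) \<Rightarrow> (nat \<Rightarrow> 'a) \<Rightarrow> nat \<Rightarrow> 'a" where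
  "fill n R x s w j = (if j < R * n then x (s (j div n)) (j mod n) else w j)"

text \<open>\<open>\<alpha>\<close> and \<open>\<beta>\<close> are the homogeneous colour delivered
  by Ramsey's theorem.\<close>

locale cut_sequence =
  fixes n T :: nat and x :: "nat \<Rightarrow> nat \<Rightarrow> rat option" and H :: "nat \<Rightarrow> nat \<Rightarrow> rat option set"
    and \<alpha> \<beta> :: "nat \<Rightarrow> nat \<Rightarrow> bool"
  assumes family: "k < n \<Longrightarrow> cut_family {..<T} (\<lambda>t. x t k) (H k)"
    and later: "s < t \<Longrightarrow> t < T \<Longrightarrow> k < n \<Longrightarrow> l < n \<Longrightarrow> x s k \<in> H l t \<longleftrightarrow> \<alpha> k l"
    and earlier: "s < t \<Longrightarrow> t < T \<Longrightarrow> k < n \<Longrightarrow> l < n \<Longrightarrow> x t k \<in> H l s \<longleftrightarrow> \<beta> k l"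
begin

text \<open>The strip between two nested half-planes; the symmetric difference makes it independent
  of the direction of the chain.\<close>

definition slice :: "nat \<Rightarrow> nat \<Rightarrow> nat \<Rightarrow> rat option set" where
  "slice k p q = (H k p - H k q) \<union> (H k q - H k p)"

definition region :: "nat \<Rightarrow> nat \<Rightarrow> rat option set" where
  "region p q = (\<Union>k\<in>{..<n}. slice k p q)"

text \<open>For \<open>s < t\<close> the bit \<open>\<beta> k k\<close> tells whether
  \<open>x t k\<close> lies in \<open>H k s\<close>. This excludes one alternative of
  \<open>chain_sets\<close> for all pairs at once, so the chain is monotone.\<close>

lemma cases_coordinate:
  assumes "k < n"
  shows "(\<forall>s<T. \<forall>t<T. x s k = x t k) \<and> (\<forall>t<T. H k t = {}) \<or>
    (\<forall>s t. s < t \<longrightarrow> t < T \<longrightarrow> H k s \<subseteq> H k t \<and> x t k \<notin> H k s \<and> x s k \<in> H k t) \<or>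
    (\<forall>s t. s < t \<longrightarrow> t < T \<longrightarrow> H k t \<subseteq> H k s \<and> x s k \<notin> H k t \<and> x t k \<in> H k s)"
proof (cases "chain_sets {..<T} (\<lambda>t. x t k) (H k)")
  case True
  have mem: "x t k \<in> H k t" if "t < T" for t
    using True that unfolding chain_sets_def by blast
  have alt: "(H k s \<subseteq> H k t \<and> x t k \<notin> H k s) \<or> (H k t \<subseteq> H k s \<and> x s k \<notin> H k t)" if "s < t" "t < T" for s t
  proof -
    have "s \<in> {..<T}" "t \<in> {..<T}" "s \<noteq> t" using that by auto
    then show ?thesis using True unfolding chain_sets_def by blast
  qed
  show ?thesis
  proof (cases "\<beta> k k")
    case True
    have "H k t \<subseteq> H k s \<and> x s k \<notin> H k t \<and> x t k \<in> H k s" if "s < t" "t < T" for s t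
      using alt[OF that] earlier[OF that assms assms] True by blast
    then show ?thesis by blast
  next
    case False
    have "H k s \<subseteq> H k t \<and> x t k \<notin> H k s \<and> x s k \<in> H k t" if "s < t" "t < T" for s t
      using alt[OF that] earlier[OF that assms assms] False mem[of t] mem[of s] that by auto
    then show ?thesis by blast
  qed
next
  case False
  then show ?thesis using family[OF assms] unfolding cut_family_def by blast
qed

text \<open>An index below \<open>p\<close> or above \<open>q\<close> is ordered in the same way
  relative to both, so no half-plane family distinguishes \<open>p\<close> from \<open>q\<close> on
  its tuple.\<close>

lemma outside_region:
  assumes "p < q" "q < T" "s < T" "s < p \<or> q < s" "k < n"
  shows "x s k \<notin> region p q"
proof -
  have "x s k \<in> H l p \<longleftrightarrow> x s k \<in> H l q" if "l < n" for l
    using assms(4)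
  proof
    assume "s < p"
    then show ?thesis using later[of s p k l] later[of s q k l] assms that by simp
  next
    assume "q < s"
    then show ?thesis using earlier[of p s k l] earlier[of q s k l] assms that by simp
  qed
  then show ?thesis unfolding region_def slice_def by blast
qed

text \<open>Monotonicity puts \<open>x s k\<close> in exactly one of the half-planes at
  \<open>p\<close> and \<open>q\<close>. Constant coordinates are harmless, since twins agree on
  them.\<close>

lemma inside_region:
  assumes "p < s" "s < q" "q < T" "k < n"
  shows "x s k \<in> region p q \<or> (\<forall>t<T. x t k = x s k)"
proof -
  have T: "s < T" "p < T" "p < q" using assms by auto
  have "x s k \<in> slice k p q \<or> (\<forall>t<T. x t k = x s k)"
    using cases_coordinate[OF assms(4)]
  proof (elim disjE)
    assume "(\<forall>s<T. \<forall>t<T. x s k = x t k) \<and> (\<forall>t<T. H k t = {})"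
    then show ?thesis using T(1) by blast
  next
    assume "\<forall>s t. s < t \<longrightarrow> t < T \<longrightarrow> H k s \<subseteq> H k t \<and> x t k \<notin> H k s \<and> x s k \<in> H k t"
    then have "x s k \<notin> H k p" "x s k \<in> H k q" using assms T by blast+
    then show ?thesis unfolding slice_def by blast
  next
    assume "\<forall>s t. s < t \<longrightarrow> t < T \<longrightarrow> H k t \<subseteq> H k s \<and> x s k \<notin> H k t \<and> x t k \<in> H k s"
    then have "x s k \<in> H k p" "x s k \<notin> H k q" using assms T by blast+
    then show ?thesis unfolding slice_def by blast
  qed
  then show ?thesis using assms(4) unfolding region_def by blast
qed

text \<open>These are successive differences along a monotone sequence of sets. Only slices of one
  coordinate are compared; whole regions may overlap.\<close>

lemma slices_disjoint:
  assumes "p < q" "q \<le> p'" "p' < q'" "q' < T" "k < n"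
  shows "slice k p q \<inter> slice k p' q' = {}"
  using cases_coordinate[OF assms(5)]
proof (elim disjE)
  assume "(\<forall>s<T. \<forall>t<T. x s k = x t k) \<and> (\<forall>t<T. H k t = {})"
  then show ?thesis using assms unfolding slice_def by auto
next
  assume m: "\<forall>s t. s < t \<longrightarrow> t < T \<longrightarrow> H k s \<subseteq> H k t \<and> x t k \<notin> H k s \<and> x s k \<in> H k t"
  have "H k p \<subseteq> H k q" "H k p' \<subseteq> H k q'" using m assms by auto
  moreover have "H k q \<subseteq> H k p'" using m assms by (cases "q = p'") auto
  ultimately show ?thesis unfolding slice_def by blast
next
  assume m: "\<forall>s t. s < t \<longrightarrow> t < T \<longrightarrow> H k t \<subseteq> H k s \<and> x s k \<notin> H k t \<and> x t k \<in> H k s"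
  have "H k q \<subseteq> H k p" "H k q' \<subseteq> H k p'" using m assms by auto
  moreover have "H k p' \<subseteq> H k q" using m assms by (cases "q = p'") auto
  ultimately show ?thesis unfolding slice_def by blast
qed

text \<open>Two half-planes per coordinate, with at most 4 boundary vertices each, give
  \<open>8 * n\<close>.\<close>

lemma region_boundary:
  assumes "p < T" "q < T"
  shows "\<exists>bs. length bs \<le> 8 * n \<and> boundary farey_graph (region p q) (set bs)"
proof -
  have "is_cone (H k t) \<or> H k t = {}" if "k < n" "t < T" for k t
    using family[OF that(1)] that(2) unfolding cut_family_def by blast
  then have "\<forall>k t. \<exists>B. k < n \<and> t < T \<longrightarrow> finite B \<and> card B \<le> 4 \<and> boundary farey_graph (H k t) B"
    using cone_boundary by meson
  then obtain B where B: "\<And>k t. k < n \<Longrightarrow> t < T \<Longrightarrow> finite (B k t) \<and> card (B k t) \<le> 4 \<and> boundary farey_graph (H k t) (B k t)"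
    by metis
  let ?B = "\<Union>k\<in>{..<n}. B k p \<union> B k q"
  have bd: "boundary farey_graph (region p q) ?B"
    unfolding region_def slice_def by (rule boundary_symdiff_Union) (use B assms in auto)
  have fin: "finite ?B" using B assms by auto
  have card: "card ?B \<le> 8 * n"
  proof -
    have "card ?B \<le> (\<Sum>k\<in>{..<n}. card (B k p \<union> B k q))" by (rule card_UN_le) simp
    also have "\<dots> \<le> (\<Sum>k\<in>{..<n}. 8)"
    proof (rule sum_mono)
      fix k assume "k \<in> {..<n}"
      then have "card (B k p) \<le> 4" "card (B k q) \<le> 4" using B assms by auto
      then show "card (B k p \<union> B k q) \<le> 8" using card_Un_le[of "B k p" "B k q"] by linarith
    qed
    finally show ?thesis by simp
  qed
  obtain bs where bs: "set bs = ?B" "distinct bs" using finite_distinct_list[OF fin] by blast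
  have "length bs \<le> 8 * n" using distinct_card[OF bs(2)] card bs(1) by simp
  moreover have "boundary farey_graph (region p q) (set bs)" using bd bs(1) by simp
  ultimately show ?thesis by (intro exI conjI)
qed

text \<open>Pigeonhole: more than \<open>card S\<close> indices lie strictly between
  \<open>p\<close> and \<open>q\<close>. \<open>J\<close> is the set of positions occupied by the
  exchanged tuple.\<close>

lemma twins:
  assumes typed: "typed_by farey_graph (8 * n) \<psi> S" and S: "finite S" "p + card S + 1 < q" "q < T"
    and J: "\<forall>j\<in>J. j mod n < n"
  shows "\<exists>s s'. p < s \<and> s < q \<and> p < s' \<and> s' < q \<and> s \<noteq> s' \<and>
    (\<forall>v v'. (\<forall>j\<in>J. v j = x s (j mod n) \<and> v' j = x s' (j mod n)) \<longrightarrow>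
       (\<forall>j. j \<notin> J \<longrightarrow> v j = v' j \<and> v j \<notin> region p q) \<longrightarrow> sat farey_graph v \<psi> = sat farey_graph v' \<psi>)"
proof -
  let ?W = "region p q"
  have "p < T" using S by simp
  then obtain bs where "length bs \<le> 8 * n" "boundary farey_graph ?W (set bs)"
    using region_boundary S(3) by blast
  then obtain f where f: "range f \<subseteq> S" "decides farey_graph ?W f \<psi>"
    by (rule typed_byE[OF typed])
  \<comment> \<open>\<open>u s\<close> is the view of the region when \<open>x s\<close> fills
    \<open>J\<close> and all other values lie outside. It is independent of the rest of the
    assignment, so the twins can be chosen before \<open>v\<close>.\<close>
  define u where "u s j = (if j \<in> J \<and> x s (j mod n) \<in> ?W then Some (x s (j mod n)) else None)" for s j
  have "\<not> inj_on (\<lambda>s. f (u s)) {p<..<q}"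
  proof
    assume "inj_on (\<lambda>s. f (u s)) {p<..<q}"
    then have "card {p<..<q} \<le> card S"
      by (rule card_inj_on_le) (use f(1) S(1) in auto)
    then show False using S(2) by simp
  qed
  then obtain s s' where s: "p < s" "s < q" "p < s'" "s' < q" "s \<noteq> s'" "f (u s) = f (u s')"
    unfolding inj_on_def by auto
  have "sat farey_graph v \<psi> = sat farey_graph v' \<psi>"
    if vJ: "\<forall>j\<in>J. v j = x s (j mod n) \<and> v' j = x s' (j mod n)"
      and vo: "\<forall>j. j \<notin> J \<longrightarrow> v j = v' j \<and> v j \<notin> ?W" for v v'
  proof -
    have "view ?W v j = u s j \<and> view ?W v' j = u s' j" for j
      using vJ[rule_format, of j] vo[rule_format, of j] by (cases "j \<in> J") (auto simp: view_def u_def)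
    then have "view ?W v = u s" "view ?W v' = u s'" by blast+
    moreover have "same_outside ?W v v'"
      unfolding same_outside_def
    proof (intro allI impI)
      fix j assume j: "v j \<notin> ?W \<or> v' j \<notin> ?W"
      show "v j = v' j"
      proof (cases "j \<in> J")
        case True
        have "j mod n < n" using J True by blast
        moreover have "x s (j mod n) \<notin> ?W \<or> x s' (j mod n) \<notin> ?W" using j vJ True by metis
        moreover have "s < T" "s' < T" using s S(3) by auto
        \<comment> \<open>By \<open>inside_region\<close>, a coordinate outside the region is
          constant along the sequence.\<close>
        ultimately have "x s (j mod n) = x s' (j mod n)"
          using inside_region[OF s(1,2) S(3), of "j mod n"] inside_region[OF s(3,4) S(3), of "j mod n"] by metis
        then show ?thesis using vJ True by metis
      next
        case False
        then show ?thesis using vo by blast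
      qed
    qed
    ultimately show ?thesis using f(2) s(6) unfolding decides_def by metis
  qed
  then show ?thesis using s(1-5) by blast
qed

text \<open>If every region met the range of \<open>w\<close>, a common point together with the
  coordinate of its slice would determine \<open>i\<close>, by disjointness of slices, and there are
  at most \<open>n * C\<close> such pairs.\<close>

lemma avoiding_region:
  assumes "finite (range w)" "card (range w) \<le> C" "n * C < R" "R * L < T" "0 < L"
  shows "\<exists>i<R. range w \<inter> region (i * L) (i * L + L) = {}"
proof (rule ccontr)
  assume "\<not> ?thesis"
  then have "\<forall>i. \<exists>z k. i < R \<longrightarrow> z \<in> range w \<and> k < n \<and> z \<in> slice k (i * L) (i * L + L)"
    unfolding region_def by blast
  then obtain z k where zk: "\<And>i. i < R \<Longrightarrow> z i \<in> range w \<and> k i < n \<and> z i \<in> slice (k i) (i * L) (i * L + L)"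
    by metis
  have disj: "slice l (i * L) (i * L + L) \<inter> slice l (j * L) (j * L + L) = {}" if "i < j" "j < R" "l < n" for i j l
  proof (rule slices_disjoint)
    have "(i + 1) * L \<le> j * L" using that by (intro mult_le_mono1) simp
    then show "i * L + L \<le> j * L" by simp
    have "(j + 1) * L \<le> R * L" using that by (intro mult_le_mono1) simp
    then show "j * L + L < T" using assms(4) by simp
  qed (use assms that in auto)
  have "inj_on (\<lambda>i. (z i, k i)) {..<R}"
  proof (rule inj_onI)
    fix i j assume ij: "i \<in> {..<R}" "j \<in> {..<R}" "(z i, k i) = (z j, k j)"
    show "i = j"
      using disj[of i j "k i"] disj[of j i "k i"] zk[of i] zk[of j] ij by (cases i j rule: linorder_cases) auto
  qed
  moreover have "(\<lambda>i. (z i, k i)) ` {..<R} \<subseteq> range w \<times> {..<n}" using zk by auto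
  ultimately have "card {..<R} \<le> card (range w \<times> {..<n})"
    using assms(1) by (intro card_inj_on_le) auto
  also have "\<dots> \<le> C * n" using assms(2) by (simp add: card_cartesian_product mult_le_mono1)
  finally show False using assms(3) by (simp add: mult.commute)
qed

text \<open>The quantifier order matters: the twins are fixed before \<open>w\<close>, which may
  depend on them; only the position \<open>i\<close> of the exchange depends on
  \<open>w\<close>.\<close>

lemma exchange:
  assumes typed: "typed_by farey_graph (8 * n) \<psi> S" and S: "finite S" and T: "R * (card S + 2) < T"
    and C: "n * C < R"
  shows "\<exists>s s'. (\<forall>i<R. s i < T \<and> s' i < T \<and> s i \<noteq> s' i) \<and>
     (\<forall>w. finite (range w) \<longrightarrow> card (range w) \<le> C \<longrightarrow>
       (\<exists>i<R. sat farey_graph (fill n R x s w) \<psi> = sat farey_graph (fill n R x (s(i := s' i)) w) \<psi>))"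
proof -
  \<comment> \<open>A window from \<open>i * L\<close> to \<open>i * L + L\<close> has
    \<open>card S + 1\<close> interior indices, one more than there are types.\<close>
  define L where "L = card S + 2"
  define J where "J i = {j. j < R * n \<and> j div n = i}" for i
  have J: "\<forall>j\<in>J i. j mod n < n" for i
    unfolding J_def by (cases "n = 0") auto
  have bound: "i * L + L < T" if "i < R" for i
  proof -
    have "(i + 1) * L \<le> R * L" using that by (intro mult_le_mono1) simp
    then show ?thesis using T unfolding L_def by simp
  qed
  define exch where "exch i a b \<longleftrightarrow> (\<forall>v v'. (\<forall>j\<in>J i. v j = x a (j mod n) \<and> v' j = x b (j mod n)) \<longrightarrow>
       (\<forall>j. j \<notin> J i \<longrightarrow> v j = v' j \<and> v j \<notin> region (i * L) (i * L + L)) \<longrightarrow>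
       sat farey_graph v \<psi> = sat farey_graph v' \<psi>)" for i a b
  have "\<exists>a b. i < R \<longrightarrow> i * L < a \<and> a < i * L + L \<and> i * L < b \<and> b < i * L + L \<and> a \<noteq> b \<and> exch i a b" for i
  proof (cases "i < R")
    case True
    have "i * L + card S + 1 < i * L + L" by (simp add: L_def)
    from twins[OF typed S this bound[OF True] J[of i]] show ?thesis
      unfolding exch_def by (elim exE, intro exI impI) assumption
  qed simp
  then obtain s s' where ss: "\<And>i. i < R \<Longrightarrow> i * L < s i \<and> s i < i * L + L \<and> i * L < s' i \<and> s' i < i * L + L \<and> s i \<noteq> s' i"
    and "\<And>i. i < R \<Longrightarrow> exch i (s i) (s' i)"
    by metis
  then have ex: "\<And>i v v'. i < R \<Longrightarrow> \<forall>j\<in>J i. v j = x (s i) (j mod n) \<and> v' j = x (s' i) (j mod n) \<Longrightarrow>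
       \<forall>j. j \<notin> J i \<longrightarrow> v j = v' j \<and> v j \<notin> region (i * L) (i * L + L) \<Longrightarrow>
       sat farey_graph v \<psi> = sat farey_graph v' \<psi>"
    unfolding exch_def by blast
  have "\<exists>i<R. sat farey_graph (fill n R x s w) \<psi> = sat farey_graph (fill n R x (s(i := s' i)) w) \<psi>"
    if w: "finite (range w)" "card (range w) \<le> C" for w
  proof -
    obtain i where i: "i < R" "range w \<inter> region (i * L) (i * L + L) = {}"
      using avoiding_region[OF w C, of L] T unfolding L_def by auto
    have "sat farey_graph (fill n R x s w) \<psi> = sat farey_graph (fill n R x (s(i := s' i)) w) \<psi>"
    proof (rule ex[OF i(1)])
      show "\<forall>j\<in>J i. fill n R x s w j = x (s i) (j mod n) \<and> fill n R x (s(i := s' i)) w j = x (s' i) (j mod n)"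
        by (auto simp: J_def fill_def)
      show "\<forall>j. j \<notin> J i \<longrightarrow> fill n R x s w j = fill n R x (s(i := s' i)) w j \<and>
          fill n R x s w j \<notin> region (i * L) (i * L + L)"
      proof (intro allI impI)
        fix j assume j: "j \<notin> J i"
        show "fill n R x s w j = fill n R x (s(i := s' i)) w j \<and> fill n R x s w j \<notin> region (i * L) (i * L + L)"
        proof (cases "j < R * n")
          case True
          then have n: "n > 0" by (cases "n = 0") auto
          have d: "j div n \<noteq> i" using j True by (simp add: J_def)
          have dR: "j div n < R" using True by (simp add: less_mult_imp_div_less)
          have sd: "j div n * L < s (j div n)" "s (j div n) < j div n * L + L" using ss[OF dR] by auto
          \<comment> \<open>The index of another block is interior to another window, hence outside
            the closed window of \<open>i\<close>.\<close>
          have "s (j div n) < i * L \<or> i * L + L < s (j div n)"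
          proof (cases "j div n < i")
            case True
            then have "(j div n + 1) * L \<le> i * L" by (intro mult_le_mono1) simp
            then show ?thesis using sd(2) by simp
          next
            case False
            then have "(i + 1) * L \<le> j div n * L" using d by (intro mult_le_mono1) simp
            then show ?thesis using sd(1) by simp
          qed
          then have "x (s (j div n)) (j mod n) \<notin> region (i * L) (i * L + L)"
            using bound[OF i(1)] bound[OF dR] sd n by (intro outside_region) (auto simp: L_def)
          then show ?thesis using True d by (simp add: fill_def)
        next
          case False
          then show ?thesis using i(2) by (auto simp: fill_def)
        qed
      qed
    qed
    then show ?thesis using i(1) by blast
  qed
  moreover have "\<forall>i<R. s i < T \<and> s' i < T \<and> s i \<noteq> s' i" using ss bound by (meson less_trans)
  ultimately show ?thesis by blast
qed

end

text \<open>Each value of \<open>w\<close> lies in at most one slice per coordinate, so that one of the \<open>R\<close> regions is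
  disjoint from the range of \<open>w\<close>; there the two twins cannot be told apart.\<close>

theorem farey_exchange:
  assumes C: "n * C < R"
  shows "\<exists>N. \<forall>x. \<exists>s s'. (\<forall>i<R. s i < N \<and> s' i < N \<and> s i \<noteq> s' i) \<and>
     (\<forall>w. finite (range w) \<longrightarrow> card (range w) \<le> C \<longrightarrow>
       (\<exists>i<R. sat farey_graph (fill n R x s w) \<psi> = sat farey_graph (fill n R x (s(i := s' i)) w) \<psi>))"
proof -
  obtain S where S: "finite S" "typed_by farey_graph (8 * n) \<psi> S"
    using finitely_many_types[of farey_graph "8 * n" \<psi>] by (auto simp: farey_graph_def)
  \<comment> \<open>Room for \<open>R\<close> adjacent windows with shared endpoints, the last
    endpoint included.\<close>
  define T where "T = R * (card S + 2) + 1"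
  define P where "P = Pow ({..<n} \<times> {..<n}) \<times> Pow ({..<n} \<times> {..<n})"
  have "finite P" by (simp add: P_def)
  from ramsey_pairs[of P T] obtain T' where T': "\<forall>F :: nat set. \<forall>c. finite F \<longrightarrow> T' \<le> card F \<longrightarrow> (\<forall>s t. c s t \<in> P) \<longrightarrow> finite P \<longrightarrow>
     (\<exists>e col. inj_on e {..<T} \<and> e ` {..<T} \<subseteq> F \<and> (\<forall>s t. s < t \<longrightarrow> t < T \<longrightarrow> c (e s) (e t) = col))"
    by (elim exE)
  \<comment> \<open>The half-planes are chosen before the colouring, which refers to them; they
    remain cut families on the homogeneous subsequence.\<close>
  from cut_families_exist[of T' n] obtain N where
    N: "\<forall>I (x :: nat \<Rightarrow> nat \<Rightarrow> rat option). finite I \<longrightarrow> N \<le> card I \<longrightarrow>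
     (\<exists>F H. F \<subseteq> I \<and> card F = T' \<and> (\<forall>k<n. cut_family F (\<lambda>i. x i k) (H k)))"
    by (elim exE)
  have "\<exists>s s'. (\<forall>i<R. s i < N \<and> s' i < N \<and> s i \<noteq> s' i) \<and>
     (\<forall>w. finite (range w) \<longrightarrow> card (range w) \<le> C \<longrightarrow>
       (\<exists>i<R. sat farey_graph (fill n R x s w) \<psi> = sat farey_graph (fill n R x (s(i := s' i)) w) \<psi>))" for x
  proof -
    have "finite {..<N}" "N \<le> card {..<N}" by simp_all
    from N[rule_format, OF this, of x] obtain F H where F: "F \<subseteq> {..<N}" "card F = T'"
      "\<forall>k<n. cut_family F (\<lambda>i. x i k) (H k)" by (elim exE conjE)
    have "finite F" using F(1) finite_subset by blast
    define c where "c s t = ({(k, l). k < n \<and> l < n \<and> x s k \<in> H l t}, {(k, l). k < n \<and> l < n \<and> x t k \<in> H l s})" for s t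
    have "c s t \<in> P" for s t by (auto simp: c_def P_def)
    from T'[rule_format, of F c, OF \<open>finite F\<close> _ this \<open>finite P\<close>] F(2) obtain e col where e: "inj_on e {..<T}" "e ` {..<T} \<subseteq> F"
      and col: "\<forall>s t. s < t \<longrightarrow> t < T \<longrightarrow> c (e s) (e t) = col" by (metis order_refl)
    interpret cut_sequence n T "\<lambda>t. x (e t)" "\<lambda>k t. H k (e t)"
      "\<lambda>k l. (k, l) \<in> fst col" "\<lambda>k l. (k, l) \<in> snd col"
    proof
      fix k assume "k < n"
      then have "cut_family (e ` {..<T}) (\<lambda>i. x i k) (H k)"
        using F(3) e(2) cut_family_subset by blast
      then show "cut_family {..<T} (\<lambda>t. x (e t) k) (\<lambda>t. H k (e t))"
        by (rule cut_family_reindex[OF _ e(1)])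
    next
      fix s t k l assume "s < t" "t < T" "k < n" "l < n"
      then show "x (e s) k \<in> H l (e t) \<longleftrightarrow> (k, l) \<in> fst col" "x (e t) k \<in> H l (e s) \<longleftrightarrow> (k, l) \<in> snd col"
        using col[rule_format, of s t] by (auto simp: c_def)
    qed
    obtain s s' where s: "\<forall>i<R. s i < T \<and> s' i < T \<and> s i \<noteq> s' i"
      and ex: "\<forall>w. finite (range w) \<longrightarrow> card (range w) \<le> C \<longrightarrow>
       (\<exists>i<R. sat farey_graph (fill n R (\<lambda>t. x (e t)) s w) \<psi> =
              sat farey_graph (fill n R (\<lambda>t. x (e t)) (s(i := s' i)) w) \<psi>)"
    proof -
      have "R * (card S + 2) < T" by (simp add: T_def)
      from exchange[OF S(2,1) this C] show ?thesis using that by (elim exE conjE)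
    qed
    have "fill n R (\<lambda>t. x (e t)) (s(i := s' i)) w = fill n R x ((e \<circ> s)(i := (e \<circ> s') i)) w"
      "fill n R (\<lambda>t. x (e t)) s w = fill n R x (e \<circ> s) w" for i w
      by (auto simp: fill_def fun_eq_iff)
    with ex have "\<forall>w. finite (range w) \<longrightarrow> card (range w) \<le> C \<longrightarrow>
       (\<exists>i<R. sat farey_graph (fill n R x (e \<circ> s) w) \<psi> =
              sat farey_graph (fill n R x ((e \<circ> s)(i := (e \<circ> s') i)) w) \<psi>)" by simp
    moreover have "\<forall>i<R. (e \<circ> s) i < N \<and> (e \<circ> s') i < N \<and> (e \<circ> s) i \<noteq> (e \<circ> s') i"
    proof (intro allI impI)
      fix i assume "i < R"
      then have "s i \<in> {..<T}" "s' i \<in> {..<T}" "s i \<noteq> s' i" using s by auto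
      moreover have "e ` {..<T} \<subseteq> {..<N}" using e(2) F(1) by blast
      ultimately show "(e \<circ> s) i < N \<and> (e \<circ> s') i < N \<and> (e \<circ> s) i \<noteq> (e \<circ> s') i"
        using e(1) by (auto simp: inj_on_eq_iff)
    qed
    ultimately show ?thesis by blast
  qed
  then show ?thesis by blast
qed

section \<open>Transfer to models of the theory\<close>

lemma sat_cong:
  "(\<And>i. i \<in> free_vars \<phi> \<Longrightarrow> v i = v' i) \<Longrightarrow> sat M v \<phi> = sat M v' \<phi>"
proof (induction \<phi> arbitrary: v v')
  case (Ex i \<phi>)
  have "sat M (v(i := a)) \<phi> = sat M (v'(i := a)) \<phi>" for a
    by (rule Ex.IH) (use Ex.prems in auto)
  then show ?case by simp
next
  case (Conj \<phi> \<psi>)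
  have "sat M v \<phi> = sat M v' \<phi>" "sat M v \<psi> = sat M v' \<psi>"
    by (rule Conj.IH; use Conj.prems in simp)+
  then show ?case by simp
next
  case (Neg \<phi>)
  have "sat M v \<phi> = sat M v' \<phi>" by (rule Neg.IH) (use Neg.prems in simp)
  then show ?case by simp
qed auto

lemma finite_free_vars: "finite (free_vars \<phi>)"
  by (induction \<phi>) auto

text \<open>The bound variable becomes an index above all images of free variables, which prevents
  capture; \<open>insert 0\<close> gives \<open>Max\<close> a nonempty set.\<close>

primrec ren :: "(nat \<Rightarrow> nat) \<Rightarrow> fm \<Rightarrow> fm" where
  "ren \<sigma> (Eq i j) = Eq (\<sigma> i) (\<sigma> j)"
| "ren \<sigma> (Adj i j) = Adj (\<sigma> i) (\<sigma> j)"
| "ren \<sigma> (Neg \<phi>) = Neg (ren \<sigma> \<phi>)"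
| "ren \<sigma> (Conj \<phi> \<psi>) = Conj (ren \<sigma> \<phi>) (ren \<sigma> \<psi>)"
| "ren \<sigma> (Ex i \<phi>) =
     (let j = Suc (Max (insert 0 (\<sigma> ` free_vars \<phi>))) in Ex j (ren (\<sigma>(i := j)) \<phi>))"

lemma sat_ren: "sat M v (ren \<sigma> \<phi>) = sat M (\<lambda>i. v (\<sigma> i)) \<phi>"
proof (induction \<phi> arbitrary: v \<sigma>)
  case (Ex i \<phi>)
  define j where "j = Suc (Max (insert 0 (\<sigma> ` free_vars \<phi>)))"
  have fresh: "\<sigma> k \<noteq> j" if "k \<in> free_vars \<phi>" for k
  proof -
    have "\<sigma> k \<le> Max (insert 0 (\<sigma> ` free_vars \<phi>))"
      using that finite_free_vars by (intro Max_ge) auto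
    then show ?thesis by (simp add: j_def)
  qed
  have "sat M (v(j := a)) (ren (\<sigma>(i := j)) \<phi>) = sat M ((\<lambda>i. v (\<sigma> i))(i := a)) \<phi>" for a
    unfolding Ex.IH by (rule sat_cong) (use fresh in auto)
  then show ?case by (simp add: j_def Let_def)
qed auto

section \<open>Quantifier blocks and finite connectives\<close>

definition exs :: "nat list \<Rightarrow> fm \<Rightarrow> fm" where
  "exs is \<phi> = foldr Ex is \<phi>"

lemma sat_exs:
  "sat M v (exs is \<phi>) \<longleftrightarrow>
     (\<exists>v'. (\<forall>i. i \<notin> set is \<longrightarrow> v' i = v i) \<and> (\<forall>i\<in>set is. v' i \<in> universe M) \<and> sat M v' \<phi>)"
proof (induction "is" arbitrary: v)
  case Nil
  have "(\<forall>i. v' i = v i) \<longleftrightarrow> v' = v" for v' by auto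
  then show ?case by (simp add: exs_def)
next
  case (Cons i "is")
  have step: "sat M v (exs (i # is) \<phi>) \<longleftrightarrow> (\<exists>a\<in>universe M. sat M (v(i := a)) (exs is \<phi>))"
    by (simp add: exs_def)
  show ?case
    unfolding step Cons.IH
  proof (intro iffI; elim bexE exE conjE)
    fix a v'
    assume a: "a \<in> universe M" and v': "\<forall>j. j \<notin> set is \<longrightarrow> v' j = (v(i := a)) j"
      "\<forall>j\<in>set is. v' j \<in> universe M" "sat M v' \<phi>"
    have "\<forall>j. j \<notin> set (i # is) \<longrightarrow> v' j = v j" using v'(1) by simp
    moreover have "\<forall>j\<in>set (i # is). v' j \<in> universe M" using v'(1,2) a by (cases "i \<in> set is") auto
    ultimately show "\<exists>v'. (\<forall>j. j \<notin> set (i # is) \<longrightarrow> v' j = v j) \<and>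
        (\<forall>j\<in>set (i # is). v' j \<in> universe M) \<and> sat M v' \<phi>" using v'(3) by blast
  next
    fix v'
    assume v': "\<forall>j. j \<notin> set (i # is) \<longrightarrow> v' j = v j"
      "\<forall>j\<in>set (i # is). v' j \<in> universe M" "sat M v' \<phi>"
    have "\<forall>j. j \<notin> set is \<longrightarrow> v' j = (v(i := v' i)) j" using v'(1) by simp
    then show "\<exists>a\<in>universe M. \<exists>v'. (\<forall>j. j \<notin> set is \<longrightarrow> v' j = (v(i := a)) j) \<and>
        (\<forall>j\<in>set is. v' j \<in> universe M) \<and> sat M v' \<phi>"
      using v'(2,3) by (intro bexI[of _ "v' i"] exI[of _ v'] conjI) auto
  qed
qed

definition alls :: "nat list \<Rightarrow> fm \<Rightarrow> fm" where
  "alls is \<phi> = Neg (exs is (Neg \<phi>))"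

lemma sat_alls:
  "sat M v (alls is \<phi>) \<longleftrightarrow>
     (\<forall>v'. (\<forall>i. i \<notin> set is \<longrightarrow> v' i = v i) \<longrightarrow> (\<forall>i\<in>set is. v' i \<in> universe M) \<longrightarrow> sat M v' \<phi>)"
  by (auto simp: alls_def sat_exs)

lemma free_vars_alls: "free_vars (alls is \<phi>) = free_vars \<phi> - set is"
  unfolding alls_def exs_def by (induction "is") auto

definition truth :: fm where "truth = Neg (Ex 0 (Neg (Eq 0 0)))"

definition conjs :: "fm list \<Rightarrow> fm" where
  "conjs \<phi>s = foldr Conj \<phi>s truth"

lemma sat_conjs: "sat M v (conjs \<phi>s) \<longleftrightarrow> (\<forall>\<phi>\<in>set \<phi>s. sat M v \<phi>)"
  by (induction \<phi>s) (auto simp: conjs_def truth_def)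

definition disjs :: "fm list \<Rightarrow> fm" where
  "disjs \<phi>s = Neg (conjs (map Neg \<phi>s))"

lemma sat_disjs: "sat M v (disjs \<phi>s) \<longleftrightarrow> (\<exists>\<phi>\<in>set \<phi>s. sat M v \<phi>)"
  by (auto simp: disjs_def sat_conjs)

definition iff :: "fm \<Rightarrow> fm \<Rightarrow> fm" where
  "iff \<phi> \<psi> = Conj (Neg (Conj \<phi> (Neg \<psi>))) (Neg (Conj \<psi> (Neg \<phi>)))"

lemma sat_iff: "sat M v (iff \<phi> \<psi>) \<longleftrightarrow> (sat M v \<phi> \<longleftrightarrow> sat M v \<psi>)"
  by (auto simp: iff_def)

text \<open>The universal closure of \<open>\<phi>\<close> over its free variables belongs to
  \<open>Th M'\<close>.\<close>

lemma transfer_universal: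
  assumes "model_of M (Th M')" "\<And>v. sat M' v \<phi>" "\<And>i. v i \<in> universe M"
  shows "sat M v \<phi>"
proof -
  define L where "L = sorted_list_of_set (free_vars \<phi>)"
  have L: "set L = free_vars \<phi>" using finite_free_vars by (simp add: L_def)
  have "alls L \<phi> \<in> Th M'"
    using assms(2) L by (simp add: Th_def sentence_def holds_def free_vars_alls sat_alls)
  then have "sat M v (alls L \<phi>)" using assms(1) unfolding model_of_def holds_def by blast
  then show ?thesis using assms(3) unfolding sat_alls by blast
qed

text \<open>In \<open>exchange_fm\<close> block \<open>t < N\<close> of \<open>n\<close> variables holds the \<open>t\<close>-th tuple, block \<open>N\<close> is quantified
  universally and the remaining \<open>m\<close> variables are parameters. The renaming \<open>select\<close> feeds \<open>R\<close> of the \<open>N\<close>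
  tuples to a formula; truncation by \<open>min\<close> keeps the number of variables that it uses bounded.\<close>

definition select :: "nat \<Rightarrow> nat \<Rightarrow> nat \<Rightarrow> nat \<Rightarrow> (nat \<Rightarrow> nat) \<Rightarrow> nat \<Rightarrow> nat" where
  "select n m R N s j = (if j < R * n then s (j div n) * n + j mod n else N * n + min (j - R * n) (n + m))"

definition exchange_fm :: "nat \<Rightarrow> nat \<Rightarrow> nat \<Rightarrow> nat \<Rightarrow> fm \<Rightarrow> (nat list \<times> nat list) list \<Rightarrow> fm" where
  "exchange_fm n m R N \<psi> ss =
     disjs (map (\<lambda>(s, s'). alls [N * n..<N * n + n]
       (disjs (map (\<lambda>i. iff (ren (select n m R N ((!) s)) \<psi>) (ren (select n m R N ((!) (s[i := s' ! i]))) \<psi>)) [0..<R]))) ss)"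

lemma sat_exchange_fm:
  "sat M v (exchange_fm n m R N \<psi> ss) \<longleftrightarrow> (\<exists>(s, s')\<in>set ss.
     \<forall>v'. (\<forall>i. i \<notin> {N * n..<N * n + n} \<longrightarrow> v' i = v i) \<longrightarrow> (\<forall>i\<in>{N * n..<N * n + n}. v' i \<in> universe M) \<longrightarrow>
       (\<exists>i<R. sat M (\<lambda>j. v' (select n m R N ((!) s) j)) \<psi> =
              sat M (\<lambda>j. v' (select n m R N ((!) (s[i := s' ! i])) j)) \<psi>))"
  by (simp add: exchange_fm_def sat_disjs sat_alls sat_iff sat_ren split_def Bex_def)

text \<open>For fixed \<open>N\<close> there are finitely many choices of twins, so
  \<open>farey_exchange\<close> becomes one formula: a disjunction over the choices, with the
  quantifier over block \<open>N\<close> inside. The bound \<open>n + m + 1\<close> counts the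
  positions that the truncation in \<open>select\<close> leaves for \<open>w\<close>.\<close>

lemma exchange_in_models:
  assumes M: "model_of M (Th farey_graph)" and R: "n * (n + m + 1) < R"
  shows "\<exists>N. \<forall>v. (\<forall>i. v i \<in> universe M) \<longrightarrow> (\<exists>s s'. (\<forall>i<R. s i < N \<and> s' i < N \<and> s i \<noteq> s' i) \<and>
     (\<forall>v'. (\<forall>i. i \<notin> {N * n..<N * n + n} \<longrightarrow> v' i = v i) \<longrightarrow> (\<forall>i. v' i \<in> universe M) \<longrightarrow>
       (\<exists>i<R. sat M (\<lambda>j. v' (select n m R N s j)) \<psi> = sat M (\<lambda>j. v' (select n m R N (s(i := s' i)) j)) \<psi>)))"
proof -
  from farey_exchange[OF R, of \<psi>] obtain N where N: "\<forall>x. \<exists>s s'. (\<forall>i<R. s i < N \<and> s' i < N \<and> s i \<noteq> s' i) \<and>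
     (\<forall>w. finite (range w) \<longrightarrow> card (range w) \<le> n + m + 1 \<longrightarrow>
       (\<exists>i<R. sat farey_graph (fill n R x s w) \<psi> = sat farey_graph (fill n R x (s(i := s' i)) w) \<psi>))"
    by (elim exE)
  define Ls where "Ls = {l. set l \<subseteq> {..<N} \<and> length l = R}"
  have "finite {(s, s'). s \<in> Ls \<and> s' \<in> Ls \<and> (\<forall>i<R. s ! i \<noteq> s' ! i)}"
    by (rule finite_subset[of _ "Ls \<times> Ls"]) (auto simp: Ls_def finite_lists_length_eq)
  from finite_list[OF this]
  obtain ss where ss: "set ss = {(s, s'). s \<in> Ls \<and> s' \<in> Ls \<and> (\<forall>i<R. s ! i \<noteq> s' ! i)}"
    by (elim exE)
  let ?\<chi> = "exchange_fm n m R N \<psi> ss"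
  have select_cong: "select n m R N s j = select n m R N s' j" if "\<And>i. i < R \<Longrightarrow> s i = s' i" for s s' j
    using that by (auto simp: select_def less_mult_imp_div_less)
  have "sat farey_graph v ?\<chi>" for v
  proof -
    let ?x = "\<lambda>t k. v (t * n + k)"
    from N[rule_format, of ?x] obtain s s' where s: "\<forall>i<R. s i < N \<and> s' i < N \<and> s i \<noteq> s' i"
      and ex: "\<forall>w. finite (range w) \<longrightarrow> card (range w) \<le> n + m + 1 \<longrightarrow>
       (\<exists>i<R. sat farey_graph (fill n R ?x s w) \<psi> = sat farey_graph (fill n R ?x (s(i := s' i)) w) \<psi>)"
      by (elim exE conjE)
    define l where "l = map s [0..<R]"
    define l' where "l' = map s' [0..<R]"
    have "(l, l') \<in> set ss" using s by (auto simp: ss Ls_def l_def l'_def)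
    moreover have "\<exists>i<R. sat farey_graph (\<lambda>j. v' (select n m R N ((!) l) j)) \<psi> =
          sat farey_graph (\<lambda>j. v' (select n m R N ((!) (l[i := l' ! i])) j)) \<psi>"
      if v': "\<forall>i. i \<notin> {N * n..<N * n + n} \<longrightarrow> v' i = v i" for v'
    proof -
      let ?w = "\<lambda>j. v' (N * n + min (j - R * n) (n + m))"
      have sub: "range ?w \<subseteq> (\<lambda>d. v' (N * n + d)) ` {..n + m}" by auto
      then have "card (range ?w) \<le> card {..n + m}" by (meson surj_card_le finite_atMost)
      moreover have "finite (range ?w)" using sub finite_surj by blast
      ultimately obtain i where i: "i < R"
        "sat farey_graph (fill n R ?x s ?w) \<psi> = sat farey_graph (fill n R ?x (s(i := s' i)) ?w) \<psi>"
        using ex[rule_format, of ?w] by auto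
      \<comment> \<open>Tuple indices are below \<open>N\<close>, so the factors are read outside
        block \<open>N\<close>, where \<open>v'\<close> agrees with \<open>v\<close>.\<close>
      have fill_eq: "(\<lambda>j. v' (select n m R N r' j)) = fill n R ?x r ?w"
        if r: "\<And>i. i < R \<Longrightarrow> r i < N" "\<And>i. i < R \<Longrightarrow> r' i = r i" for r r'
      proof
        fix j
        show "v' (select n m R N r' j) = fill n R ?x r ?w j"
        proof (cases "j < R * n")
          case True
          then have n: "0 < n" by (cases "n = 0") auto
          have d: "j div n < R" using True by (simp add: less_mult_imp_div_less)
          then have "r (j div n) + 1 \<le> N" using r(1) by (simp add: Suc_leI)
          then have "(r (j div n) + 1) * n \<le> N * n" by (rule mult_le_mono1)
          moreover have "j mod n < n" using n by simp
          ultimately have "r (j div n) * n + j mod n < N * n" by (simp only: distrib_right)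
          then have "r (j div n) * n + j mod n \<notin> {N * n..<N * n + n}" by simp
          then show ?thesis using v' True d r(2) by (simp add: select_def fill_def)
        next
          case False
          then show ?thesis by (simp add: select_def fill_def)
        qed
      qed
      have "(\<lambda>j. v' (select n m R N ((!) l) j)) = fill n R ?x s ?w"
        by (rule fill_eq) (use s in \<open>auto simp: l_def\<close>)
      moreover have "(\<lambda>j. v' (select n m R N ((!) (l[i := l' ! i])) j)) = fill n R ?x (s(i := s' i)) ?w"
        by (rule fill_eq) (use s i(1) in \<open>auto simp: l_def l'_def nth_list_update\<close>)
      ultimately show ?thesis using i by auto
    qed
    ultimately show ?thesis unfolding sat_exchange_fm by (intro bexI[of _ "(l, l')"]) simp_all
  qed
  then have main: "sat M v ?\<chi>" if "\<forall>i. v i \<in> universe M" for v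
    using transfer_universal[OF M, of ?\<chi> v] that by blast
  have "\<exists>s s'. (\<forall>i<R. s i < N \<and> s' i < N \<and> s i \<noteq> s' i) \<and>
     (\<forall>v'. (\<forall>i. i \<notin> {N * n..<N * n + n} \<longrightarrow> v' i = v i) \<longrightarrow> (\<forall>i. v' i \<in> universe M) \<longrightarrow>
       (\<exists>i<R. sat M (\<lambda>j. v' (select n m R N s j)) \<psi> = sat M (\<lambda>j. v' (select n m R N (s(i := s' i)) j)) \<psi>))"
    if v: "\<forall>i. v i \<in> universe M" for v
  proof -
    obtain l l' where l: "(l, l') \<in> set ss" and sat:
      "\<forall>v'. (\<forall>i. i \<notin> {N * n..<N * n + n} \<longrightarrow> v' i = v i) \<longrightarrow> (\<forall>i\<in>{N * n..<N * n + n}. v' i \<in> universe M) \<longrightarrow>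
       (\<exists>i<R. sat M (\<lambda>j. v' (select n m R N ((!) l) j)) \<psi> =
              sat M (\<lambda>j. v' (select n m R N ((!) (l[i := l' ! i])) j)) \<psi>)"
      using main[OF v] unfolding sat_exchange_fm by (elim bexE) (simp only: split_paired_all prod.case)
    have len: "length l = R" using l by (auto simp: ss Ls_def)
    have sel: "select n m R N ((!) (l[i := l' ! i])) = select n m R N (((!) l)(i := l' ! i))" for i
      by (rule ext, rule select_cong) (use len in \<open>auto simp: nth_list_update\<close>)
    have ex: "\<exists>i<R. sat M (\<lambda>j. v' (select n m R N ((!) l) j)) \<psi> =
        sat M (\<lambda>j. v' (select n m R N (((!) l)(i := l' ! i)) j)) \<psi>"
      if "\<forall>i. i \<notin> {N * n..<N * n + n} \<longrightarrow> v' i = v i" "\<forall>i. v' i \<in> universe M" for v'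
      using sat[rule_format, of v'] that unfolding sel by blast
    have "\<forall>i<R. l ! i < N \<and> l' ! i < N \<and> l ! i \<noteq> l' ! i"
      using l by (auto simp: ss Ls_def subset_iff)
    then show ?thesis
      by (rule exI[of _ "(!) l", OF exI[of _ "(!) l'", OF conjI]]) (rule allI, rule impI, rule impI, rule ex)
  qed
  then show ?thesis by (intro exI[of _ N] allI impI)
qed

section \<open>Groups\<close>

context group
begin

fun iterated_prod :: "(nat \<Rightarrow> 'a) \<Rightarrow> nat \<Rightarrow> 'a" where
  "iterated_prod g 0 = \<one>"
| "iterated_prod g (Suc i) = iterated_prod g i \<otimes> g i"

lemma iterated_prod_closed:
  "(\<And>i. i < R \<Longrightarrow> g i \<in> carrier G) \<Longrightarrow> iterated_prod g R \<in> carrier G"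
  by (induction R) auto

lemma iterated_prod_cong:
  "(\<And>i. i < R \<Longrightarrow> g i = h i) \<Longrightarrow> iterated_prod g R = iterated_prod h R"
  by (induction R) auto

text \<open>Common factors after position \<open>i\<close> are cancelled on the right by induction,
  the common prefix on the left; commutativity does not enter.\<close>

lemma iterated_prod_cancel:
  assumes "\<And>i. g i \<in> carrier G" "\<And>i. h i \<in> carrier G" "i < R" "\<And>j. j \<noteq> i \<Longrightarrow> g j = h j"
    and "iterated_prod g R = iterated_prod h R"
  shows "g i = h i"
  using assms(3,5)
proof (induction R)
  case (Suc R)
  have c: "iterated_prod g R \<in> carrier G" "iterated_prod h R \<in> carrier G"
    by (rule iterated_prod_closed, rule assms)+
  show ?case
  proof (cases "i = R")
    case True
    have "iterated_prod g R = iterated_prod h R"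
      by (rule iterated_prod_cong) (use True assms(4) in auto)
    then show ?thesis using Suc.prems True c assms(1,2) by simp
  next
    case False
    then have "g R = h R" using assms(4) by simp
    then have "iterated_prod g R = iterated_prod h R" using Suc.prems(2) c assms(1,2) by simp
    then show ?thesis using Suc.IH Suc.prems(1) False by simp
  qed
qed simp

end

section \<open>A formula for iterated products\<close>

definition block :: "nat \<Rightarrow> (nat \<Rightarrow> 'a) \<Rightarrow> nat \<Rightarrow> 'a list" where
  "block n v b = map (\<lambda>k. v (b + k)) [0..<n]"

lemma length_block [simp]: "length (block n v b) = n"
  by (simp add: block_def)

lemma nth_block [simp]: "k < n \<Longrightarrow> block n v b ! k = v (b + k)"
  by (simp add: block_def)

lemma block_eqI: "length xs = n \<Longrightarrow> (\<And>k. k < n \<Longrightarrow> v (b + k) = xs ! k) \<Longrightarrow> block n v b = xs"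
  by (rule nth_equalityI) simp_all

lemma block_cong: "(\<And>k. k < n \<Longrightarrow> v (b + k) = v' (b' + k)) \<Longrightarrow> block n v b = block n v' b'"
  by (rule nth_equalityI) simp_all

definition mul_vars :: "nat \<Rightarrow> nat \<Rightarrow> nat \<Rightarrow> nat \<Rightarrow> nat \<Rightarrow> nat \<Rightarrow> nat" where
  "mul_vars n b1 b2 b3 p j =
     (if j < n then b1 + j else if j < n + n then b2 + (j - n)
      else if j < n + n + n then b3 + (j - (n + n)) else p + (j - (n + n + n)))"

text \<open>Variable layout: \<open>R\<close> blocks for the factors, one for the value of the product, one for the unit,
  \<open>m\<close> parameters of the multiplication formula, then the blocks of the partial products.\<close>

definition partial_block :: "nat \<Rightarrow> nat \<Rightarrow> nat \<Rightarrow> nat \<Rightarrow> nat" where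
  "partial_block n m R i = (if i = 0 then R * n + n else if i = R then R * n else R * n + (n + n + m) + i * n)"

text \<open>Conjunct \<open>i\<close> multiplies partial product \<open>i\<close> by factor
  \<open>i\<close>. The chain starts at the unit block and ends at the value block; the quantified
  blocks supply what lies between.\<close>

definition product_fm :: "nat \<Rightarrow> nat \<Rightarrow> nat \<Rightarrow> fm \<Rightarrow> fm" where
  "product_fm n m R \<mu> = exs [R * n + (n + n + m)..<R * n + (n + n + m) + R * n]
     (conjs (map (\<lambda>i. ren (mul_vars n (partial_block n m R i) (i * n) (partial_block n m R (Suc i)) (R * n + n + n)) \<mu>) [0..<R]))"

lemma sat_conjs_upt: "sat M v (conjs (map F [0..<R])) \<longleftrightarrow> (\<forall>i<R. sat M v (F i))"
  by (auto simp: sat_conjs)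

lemma block_index_less: "(i :: nat) < R \<Longrightarrow> k < n \<Longrightarrow> i * n + k < R * n"
proof -
  assume "i < R" "k < n"
  then have "(i + 1) * n \<le> R * n" by (intro mult_le_mono1) simp
  then show ?thesis using \<open>k < n\<close> by simp
qed

locale coded_group = group G for G :: "('g, 'm) monoid_scheme" (structure) +
  fixes M :: "'a rel_structure" and n m :: nat and D :: "'a list set" and f :: "'a list \<Rightarrow> 'g"
    and \<mu> :: fm and bs :: "'a list"
  assumes tuples: "D \<subseteq> tuples M n" and onto: "f ` D = carrier G"
    and params: "length bs = m" "set bs \<subseteq> universe M"
    and vars: "free_vars \<mu> \<subseteq> {..<n + n + n + m}"
    and mul: "length xs = n \<Longrightarrow> length ys = n \<Longrightarrow> length zs = n \<Longrightarrow>
      set (xs @ ys @ zs) \<subseteq> universe M \<Longrightarrow>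
      sat M (\<lambda>i. ((xs @ ys @ zs) @ bs) ! i) \<mu> \<longleftrightarrow> xs \<in> D \<and> ys \<in> D \<and> zs \<in> D \<and> f xs \<otimes> f ys = f zs"
begin

lemma sat_mul:
  assumes "\<And>k. k < n \<Longrightarrow> v (b1 + k) \<in> universe M" "\<And>k. k < n \<Longrightarrow> v (b2 + k) \<in> universe M"
    "\<And>k. k < n \<Longrightarrow> v (b3 + k) \<in> universe M" "\<And>k. k < m \<Longrightarrow> v (p + k) = bs ! k"
  shows "sat M v (ren (mul_vars n b1 b2 b3 p) \<mu>) \<longleftrightarrow>
    block n v b1 \<in> D \<and> block n v b2 \<in> D \<and> block n v b3 \<in> D \<and> f (block n v b1) \<otimes> f (block n v b2) = f (block n v b3)"
proof -
  let ?xs = "block n v b1" and ?ys = "block n v b2" and ?zs = "block n v b3"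
  have "sat M v (ren (mul_vars n b1 b2 b3 p) \<mu>) \<longleftrightarrow> sat M (\<lambda>i. ((?xs @ ?ys @ ?zs) @ bs) ! i) \<mu>"
    unfolding sat_ren
  proof (rule sat_cong)
    fix i assume "i \<in> free_vars \<mu>"
    then have "i < n + n + n + m" using vars by blast
    then show "v (mul_vars n b1 b2 b3 p i) = ((?xs @ ?ys @ ?zs) @ bs) ! i"
      using assms(4)[of "i - (n + n + n)"] by (auto simp: mul_vars_def nth_append)
  qed
  moreover have "set (?xs @ ?ys @ ?zs) \<subseteq> universe M"
    using assms(1-3) by (auto simp: block_def)
  ultimately show ?thesis using mul by simp
qed

lemma in_tuples: "xs \<in> D \<Longrightarrow> length xs = n \<and> set xs \<subseteq> universe M"
  using tuples unfolding tuples_def by blast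

lemma code_in_carrier: "xs \<in> D \<Longrightarrow> f xs \<in> carrier G"
  using onto by blast

text \<open>An element may have many codes. Any codes satisfying the conjuncts represent the partial
  products, by induction; conversely, codes of the partial products exist because \<open>f\<close>
  is onto.\<close>

lemma sat_product_fm:
  assumes R: "0 < R" and univ: "\<And>i. v i \<in> universe M"
    and factor: "\<And>i. i < R \<Longrightarrow> block n v (i * n) \<in> D"
    and val: "block n v (R * n) \<in> D"
    and unit: "block n v (R * n + n) \<in> D" "f (block n v (R * n + n)) = \<one>"
    and par: "\<And>k. k < m \<Longrightarrow> v (R * n + n + n + k) = bs ! k"
  shows "sat M v (product_fm n m R \<mu>) \<longleftrightarrow>
    f (block n v (R * n)) = iterated_prod (\<lambda>i. f (block n v (i * n))) R"
proof -
  let ?P = "partial_block n m R" and ?g = "\<lambda>i. f (block n v (i * n))"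
  let ?I = "{R * n + (n + n + m)..<R * n + (n + n + m) + R * n}"
  have sat: "sat M v (product_fm n m R \<mu>) \<longleftrightarrow>
     (\<exists>v'. (\<forall>i. i \<notin> ?I \<longrightarrow> v' i = v i) \<and> (\<forall>i\<in>?I. v' i \<in> universe M) \<and>
       (\<forall>i<R. block n v' (?P i) \<in> D \<and> block n v' (?P (Suc i)) \<in> D \<and> 
         f (block n v' (?P i)) \<otimes> ?g i = f (block n v' (?P (Suc i)))))" (is "_ \<longleftrightarrow> (\<exists>v'. ?A v' \<and> ?B v' \<and> ?C v')")
  proof -
    have key: "(\<forall>i<R. sat M v' (ren (mul_vars n (?P i) (i * n) (?P (Suc i)) (R * n + n + n)) \<mu>)) \<longleftrightarrow> ?C v'"
      if A: "?A v'" and B: "?B v'" for v'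
    proof -
      have u: "v' i \<in> universe M" for i
        using A B univ by (cases "i \<in> ?I") auto
      have fac: "block n v' (i * n) = block n v (i * n)" if "i < R" for i
      proof (rule block_cong)
        fix k assume "k < n"
        then have "i * n + k < R * n" using that block_index_less by blast
        then show "v' (i * n + k) = v (i * n + k)" using A by simp
      qed
      have "v' (R * n + n + n + k) = bs ! k" if "k < m" for k
        using A par[OF that] that by simp
      then have "sat M v' (ren (mul_vars n (?P i) (i * n) (?P (Suc i)) (R * n + n + n)) \<mu>) \<longleftrightarrow>
         block n v' (?P i) \<in> D \<and> block n v' (?P (Suc i)) \<in> D \<and> 
         f (block n v' (?P i)) \<otimes> ?g i = f (block n v' (?P (Suc i)))" if "i < R" for i
        using sat_mul[of v' "?P i" "i * n" "?P (Suc i)" "R * n + n + n"] u fac[OF that] factor[OF that] by auto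
      then show ?thesis by blast
    qed
    have "sat M v (product_fm n m R \<mu>) \<longleftrightarrow> (\<exists>v'. ?A v' \<and> ?B v' \<and>
        (\<forall>i<R. sat M v' (ren (mul_vars n (?P i) (i * n) (?P (Suc i)) (R * n + n + n)) \<mu>)))"
      unfolding product_fm_def sat_exs by (simp add: sat_conjs_upt)
    also have "\<dots> \<longleftrightarrow> (\<exists>v'. ?A v' \<and> ?B v' \<and> ?C v')"
      by (rule ex_cong1, rule conj_cong, rule refl, rule conj_cong, rule refl, rule key)
    finally show ?thesis .
  qed
  have P0: "?P 0 = R * n + n" and PR: "?P R = R * n"
    using R by (simp_all add: partial_block_def)
  have gc: "?g i \<in> carrier G" if "i < R" for i using factor[OF that] code_in_carrier by blast
  show ?thesis
    unfolding sat
  proof (intro iffI; (elim exE conjE)?)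
    fix v' assume A: "?A v'" and C: "?C v'"
    have "block n v' (R * n + n) = block n v (R * n + n)" "block n v' (R * n) = block n v (R * n)"
      by (rule block_cong; use A in simp)+
    then have "f (block n v' (?P i)) = iterated_prod ?g i" if "i \<le> R" for i
      using that
    proof (induction i)
      case 0
      then show ?case using unit P0 by simp
    next
      case (Suc i)
      then have "i < R" "f (block n v' (?P i)) = iterated_prod ?g i" by auto
      then show ?case using C by auto
    qed
    from this[of R] \<open>block n v' (R * n) = block n v (R * n)\<close>
    show "f (block n v (R * n)) = iterated_prod ?g R" using PR by simp
  next
    assume val_eq: "f (block n v (R * n)) = iterated_prod ?g R"
    have "\<exists>xs\<in>D. f xs = iterated_prod ?g i" if "i < R" for i
    proof -
      have "iterated_prod ?g i \<in> carrier G" by (rule iterated_prod_closed) (use gc that in auto)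
      then show ?thesis using onto by (metis imageE)
    qed
    then obtain d where d: "\<And>i. i < R \<Longrightarrow> d i \<in> D \<and> f (d i) = iterated_prod ?g i" by metis
    define o' where "o' = R * n + (n + n + m)"
    define v' where "v' j = (if j \<in> ?I then d ((j - o') div n) ! ((j - o') mod n) else v j)" for j
    have A: "?A v'" by (simp add: v'_def)
    have B: "?B v'"
    proof
      fix j assume j: "j \<in> ?I"
      then have "j - o' < R * n" by (auto simp: o'_def)
      then have "(j - o') div n < R" "n > 0" by (simp add: less_mult_imp_div_less, cases "n = 0", auto)
      then have "(j - o') mod n < length (d ((j - o') div n))" "set (d ((j - o') div n)) \<subseteq> universe M"
        using d in_tuples by auto
      then show "v' j \<in> universe M" using j unfolding v'_def by (auto dest: nth_mem)
    qed
    have blk: "block n v' (?P i) \<in> D \<and> f (block n v' (?P i)) = iterated_prod ?g i" if "i \<le> R" for i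
    proof -
      consider "i = 0" | "i = R" "0 < i" | "0 < i" "i < R" using \<open>i \<le> R\<close> by linarith
      then show ?thesis
      proof cases
        case 1
        have "block n v' (R * n + n) = block n v (R * n + n)"
          by (rule block_cong) (use A in simp)
        then show ?thesis using 1 P0 unit by simp
      next
        case 2
        have "block n v' (R * n) = block n v (R * n)"
          by (rule block_cong) (use A in simp)
        then show ?thesis using 2 PR val_eq val by simp
      next
        case 3
        have "block n v' (o' + i * n) = d i"
        proof (rule block_eqI)
          show "length (d i) = n" using d in_tuples 3 by blast
          fix k assume k: "k < n"
          have "i * n + k < R * n" using block_index_less 3 k by blast
          then have "o' + i * n + k \<in> ?I" by (auto simp: o'_def)
          moreover have "(o' + i * n + k - o') div n = i" "(o' + i * n + k - o') mod n = k" using k by simp_all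
          ultimately show "v' (o' + i * n + k) = d i ! k" by (simp only: v'_def if_True)
        qed
        moreover have "?P i = o' + i * n" using 3 by (simp add: partial_block_def o'_def)
        ultimately show ?thesis using d 3 by simp
      qed
    qed
    have "?C v'"
    proof (intro allI impI)
      fix i assume i: "i < R"
      then show "block n v' (?P i) \<in> D \<and> block n v' (?P (Suc i)) \<in> D \<and> 
         f (block n v' (?P i)) \<otimes> ?g i = f (block n v' (?P (Suc i)))"
        using blk[of i] blk[of "Suc i"] by simp
    qed
    then show "\<exists>v'. ?A v' \<and> ?B v' \<and> ?C v'" using A B by blast
  qed
qed

lemma finite_carrier:
  assumes M: "model_of M (Th farey_graph)"
  shows "finite (carrier G)"
proof (rule ccontr)
  assume "infinite (carrier G)"
  then obtain g :: "nat \<Rightarrow> 'g" where g: "inj g" "range g \<subseteq> carrier G"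
    using infinite_countable_subset by blast
  have "\<forall>t. \<exists>xs\<in>D. f xs = g t" using g(2) onto by (metis imageE rangeI subsetD)
  then obtain d where d: "\<And>t. d t \<in> D" "\<And>t. f (d t) = g t" by metis
  obtain e where e: "e \<in> D" "f e = \<one>" using onto by (metis imageE one_closed)
  \<comment> \<open>Here \<open>n + m\<close> takes the place of the parameter count in
    \<open>exchange_in_models\<close>: the code of the unit and the parameters of
    \<open>\<mu>\<close>.\<close>
  define R where "R = n * (n + (n + m) + 1) + 1"
  have R: "0 < R" "n * (n + (n + m) + 1) < R" by (simp_all add: R_def)
  let ?\<psi> = "product_fm n m R \<mu>"
  from exchange_in_models[OF M R(2), of ?\<psi>] obtain N where N: "\<forall>v. (\<forall>i. v i \<in> universe M) \<longrightarrow>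
     (\<exists>s s'. (\<forall>i<R. s i < N \<and> s' i < N \<and> s i \<noteq> s' i) \<and>
     (\<forall>v'. (\<forall>i. i \<notin> {N * n..<N * n + n} \<longrightarrow> v' i = v i) \<longrightarrow> (\<forall>i. v' i \<in> universe M) \<longrightarrow>
       (\<exists>i<R. sat M (\<lambda>j. v' (select n (n + m) R N s j)) ?\<psi> =
              sat M (\<lambda>j. v' (select n (n + m) R N (s(i := s' i)) j)) ?\<psi>)))"
    by (elim exE)
  have "holds farey_graph (Ex 0 (Eq 0 0))" by (simp add: holds_def farey_graph_def)
  then have "Ex 0 (Eq 0 0) \<in> Th farey_graph" by (simp add: Th_def sentence_def)
  then have "universe M \<noteq> {}" using M unfolding model_of_def holds_def by fastforce
  then obtain a where a: "a \<in> universe M" by blast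
  define v where "v c j = (if j < N * n then d (j div n) ! (j mod n)
     else if j < N * n + n then c ! (j - N * n)
     else if j < N * n + n + n then e ! (j - (N * n + n))
     else if j < N * n + n + n + m then bs ! (j - (N * n + n + n)) else a)" for c j
  have v_univ: "v c j \<in> universe M" if c: "c \<in> D" for c j
  proof -
    have nth: "xs ! k \<in> universe M" if "xs \<in> D" "k < n" for xs k
      using in_tuples[OF that(1)] that(2) by (auto dest: nth_mem)
    have "d (j div n) ! (j mod n) \<in> universe M" if "j < N * n"
      using that nth[OF d(1)] by (cases "n = 0") auto
    moreover have "bs ! k \<in> universe M" if "k < m" for k using that params nth_mem by blast
    ultimately show ?thesis using nth[OF c] nth[OF e(1)] a unfolding v_def by auto
  qed
  \<comment> \<open>\<open>e\<close> is a placeholder in block \<open>N\<close>: the twins are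
    obtained first, and the code \<open>c\<close> of the product of the chosen factors then takes
    its place.\<close>
  have "\<forall>i. v e i \<in> universe M" using v_univ[OF e(1)] by blast
  from N[THEN spec, THEN mp, OF this] obtain s s' where s: "\<forall>i<R. s i < N \<and> s' i < N \<and> s i \<noteq> s' i"
    and ex: "\<forall>v'. (\<forall>i. i \<notin> {N * n..<N * n + n} \<longrightarrow> v' i = v e i) \<longrightarrow> (\<forall>i. v' i \<in> universe M) \<longrightarrow>
       (\<exists>i<R. sat M (\<lambda>j. v' (select n (n + m) R N s j)) ?\<psi> =
              sat M (\<lambda>j. v' (select n (n + m) R N (s(i := s' i)) j)) ?\<psi>)"
    by (elim exE conjE)
  have gs: "g t \<in> carrier G" for t using g(2) by blast
  have "iterated_prod (\<lambda>i. g (s i)) R \<in> carrier G" by (rule iterated_prod_closed) (rule gs)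
  then obtain c where c: "c \<in> D" "f c = iterated_prod (\<lambda>i. g (s i)) R" using onto by (metis imageE)
  have sat: "sat M (\<lambda>j. v c (select n (n + m) R N r j)) ?\<psi> \<longleftrightarrow>
      iterated_prod (\<lambda>i. g (s i)) R = iterated_prod (\<lambda>i. g (r i)) R"
    if r: "\<And>i. i < R \<Longrightarrow> r i < N" for r
  proof -
    let ?w = "\<lambda>j. v c (select n (n + m) R N r j)"
    have fac: "block n ?w (i * n) = d (r i)" if "i < R" for i
    proof (rule block_eqI)
      show "length (d (r i)) = n" using d(1) in_tuples by blast
      fix k assume k: "k < n"
      have "i * n + k < R * n" "r i * n + k < N * n" using block_index_less r that k by blast+
      then show "?w (i * n + k) = d (r i) ! k" using k by (simp add: select_def v_def)
    qed
    have val: "block n ?w (R * n) = c"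
      by (rule block_eqI) (use c(1) in_tuples in \<open>auto simp: select_def v_def\<close>)
    have un: "block n ?w (R * n + n) = e"
      by (rule block_eqI) (use e(1) in_tuples in \<open>auto simp: select_def v_def\<close>)
    have par: "?w (R * n + n + n + k) = bs ! k" if "k < m" for k
      using that by (simp add: select_def v_def)
    have "sat M ?w ?\<psi> \<longleftrightarrow> f (block n ?w (R * n)) = iterated_prod (\<lambda>i. f (block n ?w (i * n))) R"
    proof (rule sat_product_fm[OF R(1)])
      show "block n ?w (i * n) \<in> D" if "i < R" for i unfolding fac[OF that] by (rule d(1))
      show "block n ?w (R * n) \<in> D" unfolding val by (rule c(1))
      show "block n ?w (R * n + n) \<in> D" "f (block n ?w (R * n + n)) = \<one>" unfolding un by (rule e)+
    qed (use v_univ[OF c(1)] par in auto)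
    moreover have "iterated_prod (\<lambda>i. f (block n ?w (i * n))) R = iterated_prod (\<lambda>i. g (r i)) R"
      by (rule iterated_prod_cong) (simp only: fac d(2))
    ultimately show ?thesis using val c(2) by simp
  qed
  have "\<forall>i. i \<notin> {N * n..<N * n + n} \<longrightarrow> v c i = v e i" by (auto simp: v_def)
  then obtain i where i: "i < R" "sat M (\<lambda>j. v c (select n (n + m) R N s j)) ?\<psi> =
              sat M (\<lambda>j. v c (select n (n + m) R N (s(i := s' i)) j)) ?\<psi>"
    using ex[rule_format, of "v c"] v_univ[OF c(1)] by blast
  have r: "(s(i := s' i)) j < N" if "j < R" for j using s that by simp
  \<comment> \<open>The formula holds for \<open>s\<close> by the choice of \<open>c\<close>;
    equality of truth values transfers it to the choice with one twin exchanged.\<close>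
  have "iterated_prod (\<lambda>i. g (s i)) R = iterated_prod (\<lambda>j. g ((s(i := s' i)) j)) R"
    using i(2) sat[of s] sat[OF r] s by simp
  then have "g (s i) = g ((s(i := s' i)) i)"
    by (rule iterated_prod_cancel[OF gs gs i(1), rotated]) simp
  then have "g (s i) = g (s' i)" by simp
  then show False using g(1) s i(1) by (auto dest: injD)
qed

end

theorem corollary3p6:
  fixes M :: "'a rel_structure" and G :: "('g, 'm) monoid_scheme"
  assumes "model_of M (Th farey_graph)"
    and "group G"
    and "infinite (carrier G)"
  shows "\<not> interpretable_group M G"
proof
  assume "interpretable_group M G"
  then obtain n D f where D: "definable M n D" and onto: "f ` D = carrier G"
    and mul: "definable M (n + n + n) {xs @ ys @ zs |xs ys zs.
       xs \<in> D \<and> ys \<in> D \<and> zs \<in> D \<and> f xs \<otimes>\<^bsub>G\<^esub> f ys = f zs}"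
    unfolding interpretable_group_def by blast
  have tup: "D \<subseteq> tuples M n" using D unfolding definable_def by blast
  obtain \<mu> bs where \<mu>: "set bs \<subseteq> universe M" "free_vars \<mu> \<subseteq> {..<n + n + n + length bs}"
    and eq: "{xs @ ys @ zs |xs ys zs. xs \<in> D \<and> ys \<in> D \<and> zs \<in> D \<and> f xs \<otimes>\<^bsub>G\<^esub> f ys = f zs} =
      {xs \<in> tuples M (n + n + n). sat M (\<lambda>i. (xs @ bs) ! i) \<mu>}"
    using mul unfolding definable_def by blast
  interpret group G by (rule assms(2))
  interpret coded_group G M n "length bs" D f \<mu> bs
  proof
    fix xs ys zs :: "'a list"
    assume len: "length xs = n" "length ys = n" "length zs = n" and univ: "set (xs @ ys @ zs) \<subseteq> universe M"
    then have "xs @ ys @ zs \<in> tuples M (n + n + n)" by (simp add: tuples_def)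
    then have "sat M (\<lambda>i. ((xs @ ys @ zs) @ bs) ! i) \<mu> \<longleftrightarrow>
       xs @ ys @ zs \<in> {xs @ ys @ zs |xs ys zs. xs \<in> D \<and> ys \<in> D \<and> zs \<in> D \<and> f xs \<otimes>\<^bsub>G\<^esub> f ys = f zs}"
      unfolding eq by simp
    also have "\<dots> \<longleftrightarrow> xs \<in> D \<and> ys \<in> D \<and> zs \<in> D \<and> f xs \<otimes>\<^bsub>G\<^esub> f ys = f zs"
    proof
      assume "xs @ ys @ zs \<in> {xs @ ys @ zs |xs ys zs. xs \<in> D \<and> ys \<in> D \<and> zs \<in> D \<and> f xs \<otimes>\<^bsub>G\<^esub> f ys = f zs}"
      then obtain xs' ys' zs' where *: "xs @ ys @ zs = xs' @ ys' @ zs'" "xs' \<in> D" "ys' \<in> D" "zs' \<in> D"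
        "f xs' \<otimes>\<^bsub>G\<^esub> f ys' = f zs'" by blast
      have "length xs' = n" "length ys' = n" using *(2,3) tup by (auto simp: tuples_def)
      then have "xs = xs'" "ys = ys'" "zs = zs'" using *(1) len by auto
      then show "xs \<in> D \<and> ys \<in> D \<and> zs \<in> D \<and> f xs \<otimes>\<^bsub>G\<^esub> f ys = f zs" using * by simp
    qed blast
    finally show "sat M (\<lambda>i. ((xs @ ys @ zs) @ bs) ! i) \<mu> \<longleftrightarrow>
      xs \<in> D \<and> ys \<in> D \<and> zs \<in> D \<and> f xs \<otimes>\<^bsub>G\<^esub> f ys = f zs" .
  qed (use tup onto \<mu> in auto)
  show False using finite_carrier[OF assms(1)] assms(3) by blast
qed

end
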